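(* Let $q=3^t$ with $t\ge 1$, and let $P_\infty$ be the unique common pole of $x$ and $y$ in the function field $Z_3=\mathbb{F}_{q^2}(x,y)$ defined by $x^q+x+(y+y^3+\cdots+y^{q/3})^2=0$. Then the Weierstrass semigroup at $P_\infty$ is $$H(P_\infty)=\langle 2q/3,\ q,\ q+1\rangle .$$
   Context: $Z_3$ is a function field with full constant field $\mathbb{F}_{q^2}$; it has genus $q(q-1)/6$. The functions $x$ and $y$ have a unique common pole $P_\infty$, which is a rational (degree one) place, and no other place is a pole of $x$ or $y$. For a rational place $P$, the Weierstrass semigroup $H(P)$ is the set of non-negative integers $n$ for which there exists a function with pole divisor exactly $nP$. The notation $\langle a_1,\dots,a_r\rangle$ denotes the submonoid of $(\mathbb{Z}_{\ge 0},+)$ generated by $a_1,\dots,a_r$. *)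

theory Defs
  imports "HOL-Computational_Algebra.Polynomial"
begin

text \<open>
  Throughout, the function field is the whole type \<open>'a\<close> and its constant field is a subfield
  given as a set \<open>K :: 'a set\<close>.
\<close>

section \<open>Algebraic function fields of one variable\<close>

text \<open>Closure under \<open>inverse\<close> also concerns \<open>0\<close>, where \<open>inverse 0 = 0\<close>.\<close>

definition is_subfield :: "'a::field set \<Rightarrow> bool" where
  "is_subfield L \<longleftrightarrow>
     1 \<in> L \<and> (\<forall>a\<in>L. \<forall>b\<in>L. a - b \<in> L \<and> a * b \<in> L) \<and> (\<forall>a\<in>L. inverse a \<in> L)"

definition field_adjoin :: "'a::field set \<Rightarrow> 'a set \<Rightarrow> 'a set" where
  "field_adjoin K S = is_subfield hull (K \<union> S)"

definition transcendental_over :: "'a::field set \<Rightarrow> 'a \<Rightarrow> bool" where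
  "transcendental_over K z \<longleftrightarrow>
     \<not> (\<exists>p. p \<noteq> 0 \<and> (\<forall>i. coeff p i \<in> K) \<and> poly p z = 0)"

definition finite_degree_over :: "'a::field set \<Rightarrow> bool" where
  "finite_degree_over L \<longleftrightarrow>
     (\<exists>B. finite B \<and> (\<forall>w. \<exists>c. (\<forall>b\<in>B. c b \<in> L) \<and> w = (\<Sum>b\<in>B. c b * b)))"

definition algebraic_function_field :: "'a::field set \<Rightarrow> bool" where
  "algebraic_function_field K \<longleftrightarrow>
     is_subfield K \<and>
     (\<exists>z. transcendental_over K z \<and> finite_degree_over (field_adjoin K {z}))"

section \<open>Valuation rings, places and pole divisors\<close>

definition is_subring :: "'a::field set \<Rightarrow> bool" where
  "is_subring R \<longleftrightarrow> 1 \<in> R \<and> (\<forall>a\<in>R. \<forall>b\<in>R. a - b \<in> R \<and> a * b \<in> R)"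

definition is_ideal_of :: "'a::field set \<Rightarrow> 'a set \<Rightarrow> bool" where
  "is_ideal_of R I \<longleftrightarrow>
     I \<subseteq> R \<and> 0 \<in> I \<and> (\<forall>a\<in>I. \<forall>b\<in>I. a + b \<in> I) \<and> (\<forall>r\<in>R. \<forall>a\<in>I. r * a \<in> I)"

definition is_maximal_ideal_of :: "'a::field set \<Rightarrow> 'a set \<Rightarrow> bool" where
  "is_maximal_ideal_of R I \<longleftrightarrow>
     is_ideal_of R I \<and> I \<noteq> R \<and> (\<forall>J. is_ideal_of R J \<and> I \<subseteq> J \<longrightarrow> J = I \<or> J = R)"

definition valuation_ring :: "'a::field set \<Rightarrow> 'a set \<Rightarrow> bool" where
  "valuation_ring K R \<longleftrightarrow>
     is_subring R \<and> K \<subset> R \<and> R \<subset> UNIV \<and> (\<forall>z. z \<in> R \<or> inverse z \<in> R)"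

definition place :: "'a::field set \<Rightarrow> 'a set \<Rightarrow> bool" where
  "place K P \<longleftrightarrow> (\<exists>R. valuation_ring K R \<and> is_maximal_ideal_of R P)"

text \<open>The valuation ring belonging to a place is determined by that place.\<close>

definition place_ring :: "'a::field set \<Rightarrow> 'a set \<Rightarrow> 'a set" where
  "place_ring K P = (THE R. valuation_ring K R \<and> is_maximal_ideal_of R P)"

definition local_parameter :: "'a::field set \<Rightarrow> 'a set \<Rightarrow> 'a \<Rightarrow> bool" where
  "local_parameter K P s \<longleftrightarrow> P = (\<lambda>r. s * r) ` place_ring K P"

text \<open>
  The normalised discrete valuation of a place: every \<open>z \<noteq> 0\<close> is uniquely \<open>s\<^sup>n u\<close> with
  \<open>s\<close> a local parameter and \<open>u\<close> a unit of the valuation ring, and \<open>n\<close> does not depend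
  on \<open>s\<close>. The value at \<open>z = 0\<close> is meaningless.
\<close>

definition valuation :: "'a::field set \<Rightarrow> 'a set \<Rightarrow> 'a \<Rightarrow> int" where
  "valuation K P z =
     (THE n. \<exists>s u. local_parameter K P s \<and> u \<noteq> 0 \<and>
                   u \<in> place_ring K P \<and> inverse u \<in> place_ring K P \<and>
                   z = s powi n * u)"

definition pole_of :: "'a::field set \<Rightarrow> 'a set \<Rightarrow> 'a \<Rightarrow> bool" where
  "pole_of K P z \<longleftrightarrow> place K P \<and> z \<noteq> 0 \<and> valuation K P z < 0"

text \<open>Divisors are represented by their coefficient functions, which vanish off the places.\<close>

definition pole_divisor :: "'a::field set \<Rightarrow> 'a \<Rightarrow> 'a set \<Rightarrow> int" where
  "pole_divisor K z = (\<lambda>Q. if pole_of K Q z then - valuation K Q z else 0)"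

definition multiple_of_place :: "nat \<Rightarrow> 'a set \<Rightarrow> 'a set \<Rightarrow> int" where
  "multiple_of_place n P = (\<lambda>Q. if Q = P then int n else 0)"

section \<open>Weierstrass semigroups\<close>

definition weierstrass_semigroup :: "'a::field set \<Rightarrow> 'a set \<Rightarrow> nat set" where
  "weierstrass_semigroup K P =
     {n. \<exists>f. f \<noteq> 0 \<and> pole_divisor K f = multiple_of_place n P}"

definition is_nat_submonoid :: "nat set \<Rightarrow> bool" where
  "is_nat_submonoid M \<longleftrightarrow> 0 \<in> M \<and> (\<forall>a\<in>M. \<forall>b\<in>M. a + b \<in> M)"

definition generated_submonoid :: "nat set \<Rightarrow> nat set" where
  "generated_submonoid A = is_nat_submonoid hull A"

end

theory Submission
  imports Defs "HOL-Number_Theory.Residues"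
begin

text \<open>
  Write \<open>w = q/3\<close> and \<open>T = y + y\<^sup>3 + \<dots> + y\<^sup>w\<close>, and let \<open>A = K[x, y]\<close>. The equation of the curve is
  \<open>x\<^sup>q = - x - T\<^sup>2\<close>, and \<open>y\<^sup>q = T\<^sup>3 - T + y\<close> in characteristic 3. So the Frobenius map is given by
  explicit polynomials on \<open>A\<close>, and nearly everything below is read off from it.

  A third generator of the semigroup is supplied by \<open>z = x\<^sup>3 + y\<^sup>2 - x\<^sup>2\<close>: the two formulas yield
  \<open>z\<^sup>q = - T\<^sup>3 y + \<dots>\<close>, whose dominant term has the order of \<open>y\<^sup>q\<^sup>+\<^sup>1\<close>. With \<open>s = y/z\<close> it follows that
  \<open>x s\<^sup>2\<^sup>w\<close>, \<open>y s\<^sup>q\<close> and \<open>z s\<^sup>q\<^sup>+\<^sup>1\<close> are congruent to \<open>- 1\<close> modulo the maximal ideal of any valuation ring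
  that does not contain \<open>y\<close> (\<open>x_lead\<close>, \<open>y_lead\<close>, \<open>z_lead\<close>). The monomials \<open>x\<^sup>i y\<^sup>j z\<^sup>k\<close> with \<open>i < 3\<close> and \<open>k < w\<close> span
  \<open>A\<close> over \<open>K\<close>, and their orders \<open>2 w i + q j + (q + 1) k\<close> are distinct. Leading terms therefore do not cancel,
  and the order of every nonzero element of \<open>A\<close> is of this form (\<open>leading_term\<close>). As the function field
  consists of fractions of \<open>A\<close>, there is only one valuation ring without \<open>y\<close>, and \<open>s\<close> is a uniformizer of it.

  It remains to see that a function without further poles lies in \<open>A\<close>, i.e. that \<open>A\<close> is integrally closed, and
  that all other places are discrete, so that their valuations mean what they should. Both rest
  on two facts. First, \<open>A / bA\<close> is finite for every \<open>b \<noteq> 0\<close>, by division with remainder with respect to the order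
  at infinity. Two powers of \<open>y\<close> therefore agree modulo \<open>b\<close>, and \<open>b\<close> divides a power of \<open>y\<^sup>Q - y\<close> for some
  power \<open>Q\<close> of \<open>q\<^sup>2\<close> (\<open>divides_frob_diff_power\<close>). Second, the curve equation shows that \<open>g\<^sup>N\<close>
  is congruent to \<open>g\<close> modulo \<open>y\<^sup>Q - y\<close> for all \<open>g \<in> A\<close>, where \<open>N = Q\<^sup>3\<close> (\<open>frobenius_congruence\<close>). The second fact
  expresses that the curve is smooth and unramified over the \<open>y\<close>-line, without discriminants or traces.
  It makes \<open>y\<^sup>Q - y\<close> a uniformizer wherever it vanishes (\<open>finite_place_uniformizer\<close>) and lets one cancel
  the denominators \<open>y\<^sup>Q - y\<close> of an integral element one by one (\<open>regular_imp_in_A\<close>). A function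
  that is not integral over \<open>A\<close> has a pole elsewhere by Chevalley's extension theorem
  (\<open>exists_valuation_ring_avoiding\<close>).
\<close>

section \<open>Subrings and valuation rings of a field\<close>

lemma
  assumes "is_subring R"
  shows subring_zero: "0 \<in> R" and subring_one: "1 \<in> R"
    and subring_diff: "a \<in> R \<Longrightarrow> b \<in> R \<Longrightarrow> a - b \<in> R"
    and subring_mult: "a \<in> R \<Longrightarrow> b \<in> R \<Longrightarrow> a * b \<in> R"
    and subring_minus: "a \<in> R \<Longrightarrow> - a \<in> R"
    and subring_add: "a \<in> R \<Longrightarrow> b \<in> R \<Longrightarrow> a + b \<in> R"
    and subring_power: "a \<in> R \<Longrightarrow> a ^ n \<in> R"
proof -
  have d: "a \<in> R \<Longrightarrow> b \<in> R \<Longrightarrow> a - b \<in> R" for a b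
    using assms unfolding is_subring_def by blast
  have m: "a \<in> R \<Longrightarrow> b \<in> R \<Longrightarrow> a * b \<in> R" for a b
    using assms unfolding is_subring_def by blast
  have 1: "1 \<in> R" using assms unfolding is_subring_def by blast
  have 0: "0 \<in> R" using d[OF 1 1] by simp
  have mi: "- a \<in> R" if "a \<in> R" for a using d[OF 0 that] by simp
  show "0 \<in> R" "1 \<in> R" by fact+
  show "a \<in> R \<Longrightarrow> b \<in> R \<Longrightarrow> a - b \<in> R" by (rule d)
  show "a \<in> R \<Longrightarrow> b \<in> R \<Longrightarrow> a * b \<in> R" by (rule m)
  show "a \<in> R \<Longrightarrow> - a \<in> R" by (rule mi)
  show "a \<in> R \<Longrightarrow> b \<in> R \<Longrightarrow> a + b \<in> R" using d[OF _ mi, of a b] by simp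
  show "a \<in> R \<Longrightarrow> a ^ n \<in> R" by (induction n) (auto intro: 1 m)
qed

lemma subring_sum:
  assumes "is_subring R" "\<And>i. i \<in> I \<Longrightarrow> g i \<in> R"
  shows "sum g I \<in> R"
  using assms(2) by (induction I rule: infinite_finite_induct)
    (auto intro: subring_zero[OF assms(1)] subring_add[OF assms(1)])

lemma subfield_imp_subring: "is_subfield K \<Longrightarrow> is_subring K"
  unfolding is_subfield_def is_subring_def by blast

text \<open>
  In a valuation ring the nonunits form the unique maximal ideal, so \<open>nonunits R\<close> is the place
  that belongs to \<open>R\<close>.
\<close>

definition nonunits :: "'a::field set \<Rightarrow> 'a set" where
  "nonunits R = {r \<in> R. r = 0 \<or> inverse r \<notin> R}"

definition unit_in :: "'a::field set \<Rightarrow> 'a \<Rightarrow> bool" where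
  "unit_in R u \<longleftrightarrow> u \<noteq> 0 \<and> u \<in> R \<and> inverse u \<in> R"

context
  fixes K R :: "'a::field set"
  assumes val: "valuation_ring K R"
begin

lemma val_subring: "is_subring R" using val unfolding valuation_ring_def by blast

lemma val_const: "c \<in> K \<Longrightarrow> c \<in> R" using val unfolding valuation_ring_def by blast

lemma val_inverse: "z \<in> R \<or> inverse z \<in> R" using val unfolding valuation_ring_def by blast

lemma nonunits_subset: "a \<in> nonunits R \<Longrightarrow> a \<in> R" unfolding nonunits_def by blast

lemma zero_nonunit: "0 \<in> nonunits R"
  unfolding nonunits_def using subring_zero[OF val_subring] by blast

lemma one_notin_nonunits: "1 \<notin> nonunits R"
  unfolding nonunits_def using subring_one[OF val_subring] by simp

lemma unit_or_nonunit: "a \<in> R \<Longrightarrow> a \<in> nonunits R \<or> unit_in R a"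
  unfolding nonunits_def unit_in_def by blast

lemma unit_not_nonunit: "unit_in R a \<Longrightarrow> a \<notin> nonunits R"
  unfolding nonunits_def unit_in_def by blast

lemma inverse_nonunit: "a \<notin> R \<Longrightarrow> inverse a \<in> nonunits R"
  unfolding nonunits_def using val_inverse[of a] by simp

lemma nonunits_mult:
  assumes "a \<in> nonunits R" "b \<in> R" shows "a * b \<in> nonunits R"
proof (cases "a * b = 0")
  case True then show ?thesis using zero_nonunit by metis
next
  case False
  have "inverse (a * b) \<notin> R"
  proof
    assume "inverse (a * b) \<in> R"
    from subring_mult[OF val_subring assms(2) this]
    have "inverse a \<in> R" using False by (simp add: field_simps)
    then show False using assms False unfolding nonunits_def by auto
  qed
  then show ?thesis unfolding nonunits_def
    using assms subring_mult[OF val_subring] nonunits_subset by blast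
qed

lemma nonunits_mult2: "a \<in> R \<Longrightarrow> b \<in> nonunits R \<Longrightarrow> a * b \<in> nonunits R"
  using nonunits_mult[of b a] by (simp add: mult.commute)

lemma unit_one: "unit_in R 1"
  unfolding unit_in_def using subring_one[OF val_subring] by simp

lemma unit_mult: "unit_in R a \<Longrightarrow> unit_in R b \<Longrightarrow> unit_in R (a * b)"
  unfolding unit_in_def using subring_mult[OF val_subring] by simp

lemma unit_inverse: "unit_in R a \<Longrightarrow> unit_in R (inverse a)"
  unfolding unit_in_def by simp

lemma unit_divide: "unit_in R a \<Longrightarrow> unit_in R b \<Longrightarrow> unit_in R (a / b)"
  using unit_mult[OF _ unit_inverse] by (simp add: divide_inverse)

text \<open>
  Of two nonzero elements one divides the other in a valuation ring, so their sum is a multiple of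
  one of them.
\<close>

lemma nonunits_add:
  assumes "a \<in> nonunits R" "b \<in> nonunits R" shows "a + b \<in> nonunits R"
proof -
  have *: "a + b \<in> nonunits R"
    if "a \<in> nonunits R" "b \<in> nonunits R" "a \<noteq> 0" "inverse a * b \<in> R" for a b
  proof -
    have "a + b = a * (1 + inverse a * b)" using that(3) by (simp add: field_simps)
    then show ?thesis
      using nonunits_mult[OF that(1)] subring_add[OF val_subring subring_one[OF val_subring] that(4)]
      by metis
  qed
  consider "a = 0" | "b = 0" | "a \<noteq> 0" "b \<noteq> 0" by blast
  then show ?thesis
  proof cases
    case 3
    have "inverse a * b \<in> R \<or> inverse b * a \<in> R"
      using val_inverse[of "inverse a * b"] 3 by (simp add: mult.commute)
    then show ?thesis using *[of a b] *[of b a] assms 3 by (auto simp: add.commute)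
  qed (use assms in auto)
qed

lemma nonunits_minus: "a \<in> nonunits R \<Longrightarrow> - a \<in> nonunits R"
  using nonunits_mult[of a "- 1"] subring_minus[OF val_subring subring_one[OF val_subring]] by simp

lemma nonunits_diff: "a \<in> nonunits R \<Longrightarrow> b \<in> nonunits R \<Longrightarrow> a - b \<in> nonunits R"
  using nonunits_add[of a "- b"] nonunits_minus by simp

lemma nonunits_sum:
  "(\<And>i. i \<in> I \<Longrightarrow> g i \<in> nonunits R) \<Longrightarrow> sum g I \<in> nonunits R"
  by (induction I rule: infinite_finite_induct) (auto intro: zero_nonunit nonunits_add)

lemma nonunits_power: "a \<in> nonunits R \<Longrightarrow> n > 0 \<Longrightarrow> a ^ n \<in> nonunits R"
  by (cases n) (auto intro: nonunits_mult subring_power[OF val_subring] nonunits_subset)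

lemma val_power_imp:
  assumes "a ^ n \<in> R" "n > 0" shows "a \<in> R"
proof (rule ccontr)
  assume "a \<notin> R"
  then have "inverse a ^ n \<in> nonunits R" and "a \<noteq> 0"
    using nonunits_power[OF inverse_nonunit assms(2)] subring_zero[OF val_subring] by auto
  from nonunits_mult[OF this(1) assms(1)] this(2) show False
    using one_notin_nonunits by (simp add: power_inverse)
qed

text \<open>
  The maximal ideal is prime, even with respect to roots taken in the whole field. In characteristic
  3 this turns a congruence between \<open>3\<^sup>n\<close>-th powers into a congruence between the elements.
\<close>

lemma nonunits_power_imp:
  assumes "a ^ n \<in> nonunits R" "n > 0" shows "a \<in> nonunits R"
proof -
  have "a \<in> R" using val_power_imp assms nonunits_subset by blast
  moreover have "\<not> unit_in R a"
  proof
    assume "unit_in R a"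
    then have "inverse a ^ n \<in> R" "a \<noteq> 0"
      using subring_power[OF val_subring] unfolding unit_in_def by auto
    from nonunits_mult[OF assms(1) this(1)] this(2) show False
      using one_notin_nonunits by (simp add: power_inverse)
  qed
  ultimately show ?thesis using unit_or_nonunit by blast
qed

lemma const_unit:
  assumes "is_subfield K" "c \<in> K" "c \<noteq> 0" shows "unit_in R c"
  using assms val_const unfolding is_subfield_def unit_in_def by blast

lemma cong_unit:
  assumes "unit_in R c" "a - c \<in> nonunits R" shows "unit_in R a"
proof -
  have "a \<in> R" using subring_add[OF val_subring nonunits_subset[OF assms(2)], of c] assms(1)
    unfolding unit_in_def by simp
  moreover have "a \<notin> nonunits R"
    using nonunits_diff[OF _ assms(2), of a] unit_not_nonunit[OF assms(1)] by auto
  ultimately show ?thesis using unit_or_nonunit by blast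
qed

lemma cong_mult:
  assumes "a - c \<in> nonunits R" "b - d \<in> nonunits R" "c \<in> R" "d \<in> R"
  shows "a * b - c * d \<in> nonunits R"
proof -
  have "b \<in> R" using subring_add[OF val_subring nonunits_subset[OF assms(2)] assms(4)] by simp
  have "a * b - c * d = (a - c) * b + c * (b - d)" by (simp add: algebra_simps)
  then show ?thesis
    using nonunits_add nonunits_mult[OF assms(1) \<open>b \<in> R\<close>] nonunits_mult2[OF assms(3,2)] by simp
qed

lemma cong_power:
  assumes "a - c \<in> nonunits R" "c \<in> R"
  shows "a ^ n - c ^ n \<in> nonunits R"
  by (induction n)
    (auto intro!: cong_mult assms subring_power[OF val_subring] zero_nonunit)

lemma nonunits_maximal_ideal: "is_maximal_ideal_of R (nonunits R)"
  unfolding is_maximal_ideal_of_def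
proof (intro conjI allI impI)
  show "is_ideal_of R (nonunits R)" unfolding is_ideal_of_def
    using nonunits_subset zero_nonunit nonunits_add nonunits_mult2 by blast
  show "nonunits R \<noteq> R" using one_notin_nonunits subring_one[OF val_subring] by blast
  fix J assume J: "is_ideal_of R J \<and> nonunits R \<subseteq> J"
  show "J = nonunits R \<or> J = R"
  proof (cases "\<exists>u\<in>J. unit_in R u")
    case True
    then obtain u where u: "u \<in> J" "unit_in R u" by blast
    have "r \<in> J" if "r \<in> R" for r
    proof -
      have "r * inverse u \<in> R" using that u subring_mult[OF val_subring] unfolding unit_in_def by blast
      then have "(r * inverse u) * u \<in> J" using J u unfolding is_ideal_of_def by blast
      then show ?thesis using u unfolding unit_in_def by (simp add: mult.assoc)
    qed
    then show ?thesis using J unfolding is_ideal_of_def by blast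
  next
    case False
    then show ?thesis using J unit_or_nonunit unfolding is_ideal_of_def by blast
  qed
qed

lemma maximal_ideal_eq_nonunits:
  assumes "is_maximal_ideal_of R I" shows "I = nonunits R"
proof -
  have I: "is_ideal_of R I" "I \<noteq> R" using assms unfolding is_maximal_ideal_of_def by auto
  have "u \<notin> I" if "unit_in R u" for u
  proof
    assume "u \<in> I"
    have "r \<in> I" if "r \<in> R" for r
    proof -
      have "r * inverse u \<in> R" using that \<open>unit_in R u\<close> subring_mult[OF val_subring]
        unfolding unit_in_def by blast
      then have "(r * inverse u) * u \<in> I" using I \<open>u \<in> I\<close> unfolding is_ideal_of_def by blast
      then show ?thesis using \<open>unit_in R u\<close> unfolding unit_in_def by (simp add: mult.assoc)
    qed
    then show False using I unfolding is_ideal_of_def by blast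
  qed
  then have "I \<subseteq> nonunits R" using I unit_or_nonunit unfolding is_ideal_of_def by blast
  moreover have "nonunits R \<noteq> R" "is_ideal_of R (nonunits R)"
    using nonunits_maximal_ideal unfolding is_maximal_ideal_of_def by auto
  ultimately show ?thesis using assms unfolding is_maximal_ideal_of_def by blast
qed

text \<open>
  A place determines its valuation ring; this evaluates the definite description in
  \<open>place_ring\<close>.
\<close>

lemma ring_from_nonunits: "R = {a. a = 0 \<or> inverse a \<notin> nonunits R}"
proof -
  have "a \<in> R \<longleftrightarrow> a = 0 \<or> inverse a \<notin> nonunits R" for a
  proof (cases "a = 0")
    case True then show ?thesis using subring_zero[OF val_subring] by simp
  next
    case False
    have "inverse a \<notin> nonunits R" if "a \<in> R"
      using that False unfolding nonunits_def by auto
    then show ?thesis using inverse_nonunit False by blast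
  qed
  then show ?thesis by blast
qed

end

lemma place_iff: "place K P \<longleftrightarrow> (\<exists>R. valuation_ring K R \<and> P = nonunits R)"
  unfolding place_def using nonunits_maximal_ideal maximal_ideal_eq_nonunits by blast

lemma nonunits_inj:
  assumes "valuation_ring K R" "valuation_ring K R'" "nonunits R = nonunits R'"
  shows "R = R'"
  using ring_from_nonunits[OF assms(1)] ring_from_nonunits[OF assms(2)] assms(3) by simp

lemma place_ring_nonunits:
  assumes "valuation_ring K R" shows "place_ring K (nonunits R) = R"
  unfolding place_ring_def
proof (rule the_equality)
  show "valuation_ring K R \<and> is_maximal_ideal_of R (nonunits R)"
    using assms nonunits_maximal_ideal by blast
  fix R' assume "valuation_ring K R' \<and> is_maximal_ideal_of R' (nonunits R)"
  then show "R' = R" using nonunits_inj[OF assms] maximal_ideal_eq_nonunits by metis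
qed

subsection \<open>Discrete valuation rings\<close>

text \<open>
  That every nonzero element is a power of \<open>s\<close> times a unit is what makes \<open>valuation\<close>
  meaningful: \<open>valuation\<close> is a definite description, with an arbitrary value at a valuation ring
  that is not discrete.
\<close>

definition uniformizer :: "'a::field set \<Rightarrow> 'a \<Rightarrow> bool" where
  "uniformizer R s \<longleftrightarrow> s \<noteq> 0 \<and> s \<in> nonunits R \<and>
     (\<forall>f. f \<noteq> 0 \<longrightarrow> (\<exists>n u. unit_in R u \<and> f = s powi n * u))"

lemma powi_unit_nonneg:
  assumes val: "valuation_ring K R" and s: "s \<noteq> 0" "s \<in> nonunits R"
    and u: "unit_in R u"
  shows "s powi n * u \<in> R \<longleftrightarrow> n \<ge> 0"
proof
  assume "n \<ge> 0"
  then show "s powi n * u \<in> R"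
    using subring_mult[OF val_subring[OF val] subring_power[OF val_subring[OF val] nonunits_subset[OF val s(2)]]] u
    unfolding unit_in_def by (auto simp: power_int_def)
next
  assume *: "s powi n * u \<in> R"
  show "n \<ge> 0"
  proof (rule ccontr)
    assume n: "\<not> n \<ge> 0"
    have "s ^ nat (- n) \<in> nonunits R" using nonunits_power[OF val s(2)] n by simp
    from nonunits_mult[OF val this *] have "u \<in> nonunits R"
      using n s(1) by (simp add: power_int_def power_inverse flip: mult.assoc)
    then show False using unit_not_nonunit[OF val u] by simp
  qed
qed

context
  fixes K R :: "'a::field set" and s
  assumes val: "valuation_ring K R" and unif: "uniformizer R s"
begin

lemma s_nz: "s \<noteq> 0" and s_nonunit: "s \<in> nonunits R"
  using unif unfolding uniformizer_def by auto

lemma uniformizer_local_parameter: "local_parameter K (nonunits R) s"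
proof -
  have "f \<in> (\<lambda>r. s * r) ` R" if f: "f \<in> nonunits R" for f
  proof (cases "f = 0")
    case True then show ?thesis using subring_zero[OF val_subring[OF val]] by force
  next
    case False
    then obtain n u where nu: "unit_in R u" "f = s powi n * u"
      using unif unfolding uniformizer_def by blast
    have "n \<ge> 0" using powi_unit_nonneg[OF val s_nz s_nonunit nu(1)] nonunits_subset[OF val f] nu(2) by blast
    moreover have "n \<noteq> 0" using nu unit_not_nonunit[OF val] f by auto
    ultimately have "n - 1 \<ge> 0" by simp
    then have "s powi (n - 1) * u \<in> R"
      using powi_unit_nonneg[OF val s_nz s_nonunit nu(1)] by blast
    moreover have "f = s * (s powi (n - 1) * u)"
      using nu(2) s_nz by (simp add: power_int_diff)
    ultimately show ?thesis by blast
  qed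
  then show ?thesis unfolding local_parameter_def place_ring_nonunits[OF val]
    using nonunits_mult[OF val s_nonunit] by blast
qed

text \<open>
  Existence is the given factorisation. For uniqueness, two local parameters divide each other,
  hence differ by a unit, and then comparing the two factorisations exhibits a power of a local
  parameter that is a unit.
\<close>

lemma valuation_eq:
  assumes u: "unit_in R u" and f: "f = s powi n * u"
  shows "valuation K (nonunits R) f = n"
  unfolding valuation_def place_ring_nonunits[OF val]
proof (rule the_equality)
  show "\<exists>s u. local_parameter K (nonunits R) s \<and> u \<noteq> 0 \<and> u \<in> R \<and> inverse u \<in> R \<and> f = s powi n * u"
    using uniformizer_local_parameter u f unfolding unit_in_def by blast
  fix m
  assume "\<exists>s u. local_parameter K (nonunits R) s \<and> u \<noteq> 0 \<and> u \<in> R \<and> inverse u \<in> R \<and> f = s powi m * u"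
  then obtain s' u' where s': "local_parameter K (nonunits R) s'" and u': "unit_in R u'"
    and f': "f = s' powi m * u'" unfolding unit_in_def by blast
  have s'R: "nonunits R = (\<lambda>r. s' * r) ` R"
    using s' unfolding local_parameter_def place_ring_nonunits[OF val] .
  have s'n: "s' \<in> nonunits R" using s'R subring_one[OF val_subring[OF val]] by force
  have s'0: "s' \<noteq> 0" using s'R s_nz s_nonunit by auto
  obtain r where r: "r \<in> R" "s = s' * r" using s'R s_nonunit by auto
  obtain r' where r': "r' \<in> R" "s' = s * r'"
    using uniformizer_local_parameter s'n unfolding local_parameter_def place_ring_nonunits[OF val] by auto
  have "r * r' = 1" "r \<noteq> 0" using r r' s_nz by (auto simp: mult.commute)
  then have "inverse r = r'" by (metis inverse_unique)
  then have ru: "unit_in R r" using r r' \<open>r \<noteq> 0\<close> unfolding unit_in_def by simp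
  have rp: "unit_in R (r powi k)" for k
  proof -
    have "unit_in R (r ^ j)" for j by (induction j) (auto intro: unit_one[OF val] unit_mult[OF val] ru)
    then show ?thesis using unit_inverse[OF val] by (simp add: power_int_def power_inverse)
  qed
  have eq: "s' powi m * u' = s' powi n * (r powi n * u)"
    using f f' r(2) by (simp add: power_int_mult_distrib mult.assoc)
  have "s' powi (m - n) * (u' / (r powi n * u)) = 1"
    using eq s'0 \<open>r \<noteq> 0\<close> u u' unfolding unit_in_def
    by (simp add: power_int_diff field_simps)
  moreover have "s' powi (n - m) * ((r powi n * u) / u') = 1"
    using eq s'0 \<open>r \<noteq> 0\<close> u u' unfolding unit_in_def
    by (simp add: power_int_diff field_simps)
  moreover have "unit_in R (u' / (r powi n * u))" "unit_in R ((r powi n * u) / u')"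
    by (auto intro!: unit_divide[OF val] unit_mult[OF val] u u' rp)
  ultimately have "m - n \<ge> 0" "n - m \<ge> 0"
    using powi_unit_nonneg[OF val s'0 s'n] subring_one[OF val_subring[OF val]] by metis+
  then show "m = n" by simp
qed

lemma pole_of_iff: "pole_of K (nonunits R) f \<longleftrightarrow> f \<notin> R"
proof (cases "f = 0")
  case True then show ?thesis using subring_zero[OF val_subring[OF val]] unfolding pole_of_def by simp
next
  case False
  then obtain n u where nu: "unit_in R u" "f = s powi n * u"
    using unif unfolding uniformizer_def by blast
  have "place K (nonunits R)" using place_iff val by blast
  then show ?thesis
    using valuation_eq[OF nu] powi_unit_nonneg[OF val s_nz s_nonunit nu(1)] False nu(2)
    unfolding pole_of_def by (metis not_le)
qed

end

subsection \<open>Existence of valuation rings\<close>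

text \<open>
  The set \<open>adjoin B w\<close> is the ring \<open>B[w]\<close>. The relation \<open>f \<in> adjoin B (inverse f)\<close> says that \<open>f\<close>
  is integral over \<open>B\<close>: multiply \<open>f = b\<^sub>0 + b\<^sub>1 f\<^sup>-\<^sup>1 + \<dots> + b\<^sub>n f\<^sup>-\<^sup>n\<close> by \<open>f\<^sup>n\<close>.
\<close>

definition adjoin :: "'a::field set \<Rightarrow> 'a \<Rightarrow> 'a set" where
  "adjoin B w = {poly p w | p. \<forall>i. Polynomial.coeff p i \<in> B}"

lemma adjoinI: "(\<And>i. Polynomial.coeff p i \<in> B) \<Longrightarrow> a = poly p w \<Longrightarrow> a \<in> adjoin B w"
  unfolding adjoin_def by blast

lemma adjoin_subring:
  assumes "is_subring B" shows "is_subring (adjoin B w)"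
  unfolding is_subring_def
proof (intro conjI ballI)
  show "1 \<in> adjoin B w"
    by (rule adjoinI[of 1]) (auto simp: coeff_1 subring_one[OF assms] subring_zero[OF assms])
  fix a b assume "a \<in> adjoin B w" "b \<in> adjoin B w"
  then obtain p r where p: "a = poly p w" "\<forall>i. Polynomial.coeff p i \<in> B" and r: "b = poly r w" "\<forall>i. Polynomial.coeff r i \<in> B"
    unfolding adjoin_def by blast
  show "a - b \<in> adjoin B w"
    by (rule adjoinI[of "p - r"]) (use p r subring_diff[OF assms] in auto)
  show "a * b \<in> adjoin B w"
    by (rule adjoinI[of "p * r"])
      (use p r in \<open>auto simp: coeff_mult intro!: subring_sum[OF assms] subring_mult[OF assms]\<close>)
qed

lemma adjoin_superset:
  assumes "is_subring B" shows "B \<subseteq> adjoin B w" "w \<in> adjoin B w"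
proof -
  note c = subring_zero[OF assms] subring_one[OF assms]
  show "B \<subseteq> adjoin B w"
    by (rule subsetI, rule adjoinI[of "[:_:]"]) (auto simp: coeff_pCons c split: nat.split)
  show "w \<in> adjoin B w"
    by (rule adjoinI[of "[:0, 1:]"]) (auto simp: coeff_pCons c split: nat.split)
qed

text \<open>
  This is the elimination in Chevalley's extension theorem. Let \<open>m \<le> n\<close>. Since \<open>1 - b\<^sub>0\<close> can be
  inverted, the relation in \<open>1/z\<close> expresses \<open>z\<^sup>n\<close> by lower powers of \<open>z\<close> with coefficients in \<open>I\<close>;
  substituting this shortens the relation in \<open>z\<close>. The two relations play symmetric roles, so one of
  them eventually reads \<open>1 \<in> I\<close>.
\<close>

lemma no_opposite_relations:
  fixes z :: "'a::field" and I :: "'a set"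
  assumes z: "z \<noteq> 0" and one: "1 \<notin> I"
    and add: "\<And>a b. a \<in> I \<Longrightarrow> b \<in> I \<Longrightarrow> a + b \<in> I"
    and mult: "\<And>a b. a \<in> I \<Longrightarrow> b \<in> I \<Longrightarrow> a * b \<in> I"
    and unit: "\<And>a b. a \<in> I \<Longrightarrow> b \<in> I \<Longrightarrow> a / (1 - b) \<in> I"
  shows "\<lbrakk>\<forall>i. a i \<in> I; \<forall>j. b j \<in> I; (\<Sum>i\<le>n. a i * z ^ i) = 1; (\<Sum>j\<le>m. b j * inverse z ^ j) = 1\<rbrakk> \<Longrightarrow> False"
  using z
proof (induction "n + m" arbitrary: n m a b z rule: less_induct)
  case less
  have main: False if ab: "\<forall>i. a i \<in> I" "\<forall>j. b j \<in> I" "(\<Sum>i\<le>n. a i * z ^ i) = 1"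
      "(\<Sum>j\<le>m. b j * inverse z ^ j) = 1" "z \<noteq> 0" and mn: "m \<le> n"
    and IH: "\<And>a'. \<lbrakk>\<forall>i. a' i \<in> I; n > 0; (\<Sum>i\<le>n-1. a' i * z ^ i) = 1\<rbrakk> \<Longrightarrow> False"
    for n m z and a b :: "nat \<Rightarrow> 'a"
  proof (cases "m = 0")
    case True
    then have "b 0 = 1" using ab(4) by simp
    then show False using ab(2) one by metis
  next
    case False
    then have n: "n > 0" using mn by simp
    have b0: "1 - b 0 \<noteq> 0" using ab(2) one by (metis eq_iff_diff_eq_0)
    define b' where "b' j = (if j \<le> m then b j / (1 - b 0) else 0)" for j
    have s0: "(\<Sum>j=1..m. b j * inverse z ^ j) = 1 - b 0"
    proof -
      have "{..m} = insert 0 {1..m}" by auto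
      then show ?thesis using ab(4) by (simp add: algebra_simps)
    qed
    have "(\<Sum>j=1..n. b' j * inverse z ^ j) = (\<Sum>j=1..m. b' j * inverse z ^ j)"
      by (rule sum.mono_neutral_right) (use mn in \<open>auto simp: b'_def\<close>)
    also have "\<dots> = (\<Sum>j=1..m. b j * inverse z ^ j) / (1 - b 0)"
      unfolding sum_divide_distrib by (rule sum.cong) (auto simp: b'_def)
    finally have s1: "(\<Sum>j=1..n. b' j * inverse z ^ j) = 1" using s0 b0 by simp
    have s2: "(\<Sum>i<n. b' (n - i) * z ^ i) = z ^ n"
    proof -
      have "(\<Sum>i<n. b' (n - i) * z ^ i) = (\<Sum>j=1..n. b' j * z ^ (n - j))"
        by (rule sum.reindex_bij_witness[of _ "\<lambda>j. n - j" "\<lambda>j. n - j"]) auto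
      also have "\<dots> = (\<Sum>j=1..n. z ^ n * (b' j * inverse z ^ j))"
        using ab(5) by (intro sum.cong) (auto simp: power_diff power_inverse field_simps)
      finally show ?thesis using s1 by (simp flip: sum_distrib_left)
    qed
    \<comment> \<open>coefficients after replacing the top power by \<open>s2\<close>\<close>
    define a' where "a' i = a i + a n * b' (n - i)" for i
    have "a' i \<in> I" if "n - i \<le> m" for i
      unfolding a'_def b'_def using that ab unit add mult by auto
    then have a'I: "\<forall>i. (if n - i \<le> m then a' i else a i) \<in> I" using ab by simp
    have "{..n} = insert n {..<n}" by auto
    then have "(\<Sum>i<n. a i * z ^ i) + a n * z ^ n = 1" using ab(3) by (simp add: add.commute)
    then have "(\<Sum>i<n. a' i * z ^ i) = 1"
      unfolding a'_def s2[symmetric] by (simp add: ring_distribs sum.distrib sum_distrib_left mult.assoc)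
    moreover have "(\<Sum>i\<le>n-1. (if n - i \<le> m then a' i else a i) * z ^ i) = (\<Sum>i<n. a' i * z ^ i)"
      by (rule sum.cong) (use n in \<open>auto simp: a'_def b'_def\<close>)
    ultimately show False using IH[OF a'I n] by simp
  qed
  show False
  proof (cases "m \<le> n")
    case True
    show False
      by (rule main[OF less.prems True]) (rule less.hyps[of "n - 1" m], use less.prems True in auto)
  next
    case False
    show False
      by (rule main[of b a "inverse z" m n])
        (use less.prems False less.hyps[of "m - 1" n _ a "inverse z"] in \<open>auto simp: add.commute\<close>)
  qed
qed

text \<open>
  A ring that is maximal among the extensions of \<open>B[1/f]\<close> without \<open>f\<close> is a valuation ring. Write
  \<open>u = 1/f\<close>. Maximality makes every \<open>1 - u b\<close> a unit, for otherwise \<open>f\<close> would be a polynomial in its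
  inverse, and clearing denominators puts \<open>f\<close> into the ring. If both \<open>z\<close> and \<open>1/z\<close> were missing,
  adjoining either would produce \<open>f\<close>, which amounts to two relations of the kind excluded by
  \<open>no_opposite_relations\<close>, with \<open>I\<close> the multiples of \<open>u\<close>.
\<close>

lemma exists_valuation_ring_avoiding:
  assumes B: "is_subring B" and f: "f \<notin> adjoin B (inverse f)"
  shows "\<exists>R. is_subring R \<and> B \<subseteq> R \<and> f \<notin> R \<and> (\<forall>z. z \<in> R \<or> inverse z \<in> R)"
proof -
  define C where "C = {R. is_subring R \<and> adjoin B (inverse f) \<subseteq> R \<and> f \<notin> R}"
  have "\<exists>M\<in>C. \<forall>X\<in>C. M \<subseteq> X \<longrightarrow> X = M"
  proof (rule subset_Zorn_nonempty)
    show "C \<noteq> {}" unfolding C_def using adjoin_subring[OF B] f by blast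
    fix c assume c: "c \<noteq> {}" "subset.chain C c"
    then have sub: "c \<subseteq> C" and tot: "\<And>X Y. X \<in> c \<Longrightarrow> Y \<in> c \<Longrightarrow> X \<subseteq> Y \<or> Y \<subseteq> X"
      unfolding subset_chain_def by blast+
    have "is_subring (\<Union>c)"
      unfolding is_subring_def
    proof (intro conjI ballI)
      show "1 \<in> \<Union>c" using c(1) sub subring_one unfolding C_def by blast
      fix a b assume "a \<in> \<Union>c" "b \<in> \<Union>c"
      then obtain X where "X \<in> c" "a \<in> X" "b \<in> X" using tot by blast
      then show "a - b \<in> \<Union>c" "a * b \<in> \<Union>c"
        using sub subring_diff[of X] subring_mult[of X] unfolding C_def by blast+
    qed
    then show "\<Union>c \<in> C" using c(1) sub unfolding C_def by blast
  qed
  then obtain M where MC: "M \<in> C" and max: "\<And>X. X \<in> C \<Longrightarrow> M \<subseteq> X \<Longrightarrow> X = M" by blast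
  have M: "is_subring M" "adjoin B (inverse f) \<subseteq> M" "f \<notin> M" using MC unfolding C_def by auto
  define u where "u = inverse f"
  have uM: "u \<in> M" using M(2) adjoin_superset[OF B] unfolding u_def by blast
  have f0: "f \<noteq> 0" using M subring_zero by blast
  have uf: "u * f = 1" using f0 unfolding u_def by simp
  have ext: "f \<in> adjoin M w" if "w \<notin> M" for w
  proof (rule ccontr)
    assume "f \<notin> adjoin M w"
    then have "adjoin M w \<in> C" unfolding C_def
      using adjoin_subring[OF M(1)] adjoin_superset[OF M(1), of w] M(2) by blast
    from max[OF this] adjoin_superset[OF M(1), of w] that show False by blast
  qed
  have inv: "1 - u * b \<noteq> 0 \<and> inverse (1 - u * b) \<in> M" if b: "b \<in> M" for b
  proof
    show n0: "1 - u * b \<noteq> 0"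
    proof
      assume "1 - u * b = 0"
      then have "u * b = u * f" using uf by simp
      moreover have "u \<noteq> 0" using f0 unfolding u_def by simp
      ultimately show False using M(3) b by (metis mult_left_cancel)
    qed
    show "inverse (1 - u * b) \<in> M"
    proof (rule ccontr)
      assume "inverse (1 - u * b) \<notin> M"
      from ext[OF this] obtain p where p: "\<forall>i. Polynomial.coeff p i \<in> M" "f = poly p (inverse (1 - u * b))"
        unfolding adjoin_def by blast
      define n where "n = degree p"
      have "f * (1 - u * b) ^ n = (\<Sum>i\<le>n. Polynomial.coeff p i * (1 - u * b) ^ (n - i))"
        unfolding p(2) poly_altdef n_def sum_distrib_right
        using n0 by (intro sum.cong) (auto simp: power_diff power_inverse field_simps)
      also have "\<dots> \<in> M"
        using p(1) b uM M(1) by (intro subring_sum subring_mult subring_power subring_diff) (auto intro: subring_one)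
      finally have 1: "f * (1 - u * b) ^ n \<in> M" .
      have "\<exists>b'\<in>M. (1 - u * b) ^ n = 1 - u * b'"
      proof (induction n)
        case 0 show ?case by (rule bexI[of _ 0]) (auto intro: subring_zero M)
      next
        case (Suc n)
        then obtain b' where b': "b' \<in> M" "(1 - u * b) ^ n = 1 - u * b'" by blast
        have "(1 - u * b) ^ Suc n = 1 - u * (b + b' - u * b * b')"
          unfolding power_Suc b'(2) by (simp add: algebra_simps)
        moreover have "b + b' - u * b * b' \<in> M"
          using b' b uM M(1) by (intro subring_diff subring_add subring_mult)
        ultimately show ?case by blast
      qed
      then obtain b' where b': "b' \<in> M" "(1 - u * b) ^ n = 1 - u * b'" by blast
      have "f * (1 - u * b') = f - (u * f) * b'" by (simp add: algebra_simps)
      then have "f * (1 - u * b) ^ n = f - b'" using b'(2) uf by simp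
      then have "f = f * (1 - u * b) ^ n + b'" by simp
      then show False using subring_add[OF M(1) 1 b'(1)] M(3) by simp
    qed
  qed
  have "z \<in> M \<or> inverse z \<in> M" for z
  proof (rule ccontr)
    assume "\<not> (z \<in> M \<or> inverse z \<in> M)"
    then have z: "z \<notin> M" "inverse z \<notin> M" by auto
    have z0: "z \<noteq> 0" using z subring_zero[OF M(1)] by blast
    have rel: "\<exists>a n. (\<forall>i. a i \<in> (\<lambda>b. u * b) ` M) \<and> (\<Sum>i\<le>n. a i * w ^ i) = 1" if "w \<notin> M" for w
    proof -
      obtain p where p: "\<forall>i. Polynomial.coeff p i \<in> M" "f = poly p w" using ext[OF \<open>w \<notin> M\<close>] unfolding adjoin_def by blast
      have "(\<Sum>i\<le>degree p. (u * Polynomial.coeff p i) * w ^ i) = u * f"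
        unfolding p(2) poly_altdef sum_distrib_left by (simp add: mult.assoc)
      then show ?thesis using p(1) uf by (intro exI[of _ "\<lambda>i. u * Polynomial.coeff p i"] exI[of _ "degree p"]) auto
    qed
    obtain a n where a: "\<forall>i. a i \<in> (\<lambda>b. u * b) ` M" "(\<Sum>i\<le>n. a i * z ^ i) = 1" using rel[OF z(1)] by blast
    obtain b m where b: "\<forall>i. b i \<in> (\<lambda>b. u * b) ` M" "(\<Sum>i\<le>m. b i * inverse z ^ i) = 1" using rel[OF z(2)] by blast
    show False
    proof (rule no_opposite_relations[OF z0 _ _ _ _ a(1) b(1) a(2) b(2)])
      show "1 \<notin> (\<lambda>b. u * b) ` M"
      proof
        assume "1 \<in> (\<lambda>b. u * b) ` M"
        then obtain b where "b \<in> M" "u * b = 1" by auto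
        then show False using inv[of b] by (metis diff_self)
      qed
    next
      fix a b assume "a \<in> (\<lambda>b. u * b) ` M" "b \<in> (\<lambda>b. u * b) ` M"
      then obtain a' b' where *: "a' \<in> M" "b' \<in> M" "a = u * a'" "b = u * b'" by blast
      have "a + b = u * (a' + b')" "a' + b' \<in> M" using * subring_add[OF M(1)] by (auto simp: algebra_simps)
      then show "a + b \<in> (\<lambda>b. u * b) ` M" by blast
      have "a * b = u * (a' * b)" "a' * b \<in> M" using * uM subring_mult[OF M(1)] by (auto simp: algebra_simps)
      then show "a * b \<in> (\<lambda>b. u * b) ` M" by blast
      have "a / (1 - b) = u * (a' * inverse (1 - u * b'))" "a' * inverse (1 - u * b') \<in> M"
        using * inv[of b'] subring_mult[OF M(1)] by (auto simp: divide_inverse mult.assoc)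
      then show "a / (1 - b) \<in> (\<lambda>b. u * b) ` M" by blast
    qed
  qed
  then show ?thesis using M adjoin_superset[OF B] by blast
qed

section \<open>Spans, integral elements and ideals\<close>

inductive_set lin_span :: "'a::field set \<Rightarrow> 'a set \<Rightarrow> 'a set" for K B where
  zero: "0 \<in> lin_span K B"
| add: "\<lbrakk>f \<in> lin_span K B; c \<in> K; b \<in> B\<rbrakk> \<Longrightarrow> f + c * b \<in> lin_span K B"

lemma lin_span_add:
  assumes "f \<in> lin_span K B" "g \<in> lin_span K B" shows "f + g \<in> lin_span K B"
  using assms(2,1) by induction (auto simp: add.assoc[symmetric] intro: lin_span.add)

lemma lin_span_scale:
  assumes K: "is_subring K" and c: "c \<in> K" and f: "f \<in> lin_span K B"
  shows "c * f \<in> lin_span K B"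
  using f
proof induction
  case zero show ?case using lin_span.zero by simp
next
  case (add f d b)
  then show ?case using lin_span.add[OF add.IH subring_mult[OF K c add.hyps(2)] add.hyps(3)]
    by (simp add: algebra_simps)
qed

lemma lin_span_minus:
  "is_subring K \<Longrightarrow> f \<in> lin_span K B \<Longrightarrow> - f \<in> lin_span K B"
  using lin_span_scale[of K "- 1" f B] subring_minus[of K 1] subring_one[of K] by simp

lemma lin_span_base: "is_subring K \<Longrightarrow> b \<in> B \<Longrightarrow> b \<in> lin_span K B"
  using lin_span.add[OF lin_span.zero, of 1 K b B] subring_one[of K] by simp

lemma lin_span_mono: "B \<subseteq> B' \<Longrightarrow> f \<in> lin_span K B \<Longrightarrow> f \<in> lin_span K B'"
  by (erule lin_span.induct) (auto intro: lin_span.intros)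

lemma lin_span_mult:
  assumes K: "is_subring K" and "\<And>b. b \<in> B \<Longrightarrow> h * b \<in> lin_span K B'" and f: "f \<in> lin_span K B"
  shows "h * f \<in> lin_span K B'"
  using f
proof induction
  case zero show ?case using lin_span.zero by simp
next
  case (add f c b)
  then show ?case using lin_span_add[OF add.IH lin_span_scale[OF K add.hyps(2) assms(2)[OF add.hyps(3)]]]
    by (simp add: algebra_simps)
qed

lemma lin_span_sum:
  "(\<And>i. i \<in> I \<Longrightarrow> g i \<in> lin_span K B) \<Longrightarrow> sum g I \<in> lin_span K B"
  by (induction I rule: infinite_finite_induct) (auto intro: lin_span.zero lin_span_add)

text \<open>
  Zero coefficients are dropped, so that a nonzero element has at least one term and each
  term has a definite order later on.
\<close>

lemma lin_span_imp_sum: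
  assumes K: "is_subring K" and f: "f \<in> lin_span K (g ` I)"
  shows "\<exists>T c. finite T \<and> T \<subseteq> I \<and> (\<forall>\<tau>\<in>T. c \<tau> \<in> K - {0}) \<and> f = (\<Sum>\<tau>\<in>T. c \<tau> * g \<tau>)"
proof -
  have "\<exists>T c. finite T \<and> T \<subseteq> I \<and> (\<forall>\<tau>. c \<tau> \<in> K) \<and> f = (\<Sum>\<tau>\<in>T. c \<tau> * g \<tau>)"
    using f
  proof induction
    case zero
    show ?case by (rule exI[of _ "{}"], rule exI[of _ "\<lambda>_. 0"]) (auto intro: subring_zero K)
  next
    case (add f d b)
    then obtain T c \<sigma> where *: "finite T" "T \<subseteq> I" "\<forall>\<tau>. c \<tau> \<in> K" "f = (\<Sum>\<tau>\<in>T. c \<tau> * g \<tau>)"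
      "\<sigma> \<in> I" "b = g \<sigma>" by blast
    define c' where "c' = (\<lambda>\<tau>. (if \<tau> \<in> T then c \<tau> else 0) + (if \<tau> = \<sigma> then d else 0))"
    have "(\<Sum>\<tau>\<in>insert \<sigma> T. c' \<tau> * g \<tau>) =
        (\<Sum>\<tau>\<in>insert \<sigma> T. (if \<tau> \<in> T then c \<tau> else 0) * g \<tau>) + (\<Sum>\<tau>\<in>insert \<sigma> T. (if \<tau> = \<sigma> then d else 0) * g \<tau>)"
      unfolding c'_def by (simp add: distrib_right sum.distrib)
    also have "(\<Sum>\<tau>\<in>insert \<sigma> T. (if \<tau> \<in> T then c \<tau> else 0) * g \<tau>) = f"
      unfolding *(4) by (rule sum.mono_neutral_cong_right) (use * in auto)
    also have "(\<Sum>\<tau>\<in>insert \<sigma> T. (if \<tau> = \<sigma> then d else 0) * g \<tau>) = (\<Sum>\<tau>\<in>{\<sigma>}. d * g \<tau>)"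
      by (rule sum.mono_neutral_cong_right) (use * in auto)
    finally have "f + d * b = (\<Sum>\<tau>\<in>insert \<sigma> T. c' \<tau> * g \<tau>)" using * by simp
    moreover have "\<forall>\<tau>. c' \<tau> \<in> K" unfolding c'_def
      using * add.hyps subring_add[OF K] subring_zero[OF K] by auto
    moreover have "finite (insert \<sigma> T)" "insert \<sigma> T \<subseteq> I" using * by auto
    ultimately show ?case by (intro exI[of _ "insert \<sigma> T"] exI[of _ c'] conjI)
  qed
  then obtain T c where *: "finite T" "T \<subseteq> I" "\<forall>\<tau>. c \<tau> \<in> K" "f = (\<Sum>\<tau>\<in>T. c \<tau> * g \<tau>)" by blast
  have "f = (\<Sum>\<tau>\<in>{\<tau>\<in>T. c \<tau> \<noteq> 0}. c \<tau> * g \<tau>)"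
    unfolding *(4) by (rule sum.mono_neutral_right) (use *(1) in auto)
  moreover have "finite {\<tau>\<in>T. c \<tau> \<noteq> 0}" "{\<tau>\<in>T. c \<tau> \<noteq> 0} \<subseteq> I"
    using *(1,2) by auto
  moreover have "\<forall>\<tau>\<in>{\<tau>\<in>T. c \<tau> \<noteq> 0}. c \<tau> \<in> K - {0}" using *(3) by simp
  ultimately show ?thesis by (intro exI[of _ "{\<tau>\<in>T. c \<tau> \<noteq> 0}"] exI[of _ c] conjI)
qed

lemma finite_lin_span:
  assumes "finite K" "is_subring K" "finite B" shows "finite (lin_span K B)"
  using assms(3)
proof induction
  case empty
  have "f = 0" if "f \<in> lin_span K {}" for f using that by induction auto
  then show ?case using finite_subset[of _ "{0}"] by blast
next
  case (insert b B)
  have "f \<in> (\<lambda>(c, g). c * b + g) ` (K \<times> lin_span K B)" if "f \<in> lin_span K (insert b B)" for f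
    using that
  proof induction
    case zero
    show ?case by (rule image_eqI[of _ _ "(0, 0)"]) (auto intro: subring_zero assms lin_span.zero)
  next
    case (add f c b')
    then obtain d g where *: "d \<in> K" "g \<in> lin_span K B" "f = d * b + g" by auto
    show ?case
    proof (cases "b' = b")
      case True
      then show ?thesis
        by (intro image_eqI[of _ _ "(d + c, g)"])
          (use * add.hyps subring_add[OF assms(2)] in \<open>auto simp: algebra_simps\<close>)
    next
      case False
      then show ?thesis
        by (intro image_eqI[of _ _ "(d, g + c * b')"]) (use * add.hyps lin_span.add in auto)
    qed
  qed
  then show ?case using insert.IH assms(1) by (meson finite_SigmaI finite_imageI finite_subset subsetI)
qed

text \<open>
  The integral equation of degree \<open>n + 1\<close> allows every power of \<open>f\<close> to be reduced to the first
  \<open>n + 1\<close> powers.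
\<close>

lemma integral_powers:
  assumes B: "is_subring B" and f: "f \<in> adjoin B (inverse f)"
  shows "\<exists>n. \<forall>k. f ^ k \<in> lin_span B ((\<lambda>i. f ^ i) ` {..n})"
proof -
  obtain p where p: "f = poly p (inverse f)" "\<forall>i. Polynomial.coeff p i \<in> B"
    using f unfolding adjoin_def by blast
  define n where "n = degree p"
  define W where "W = lin_span B ((\<lambda>i. f ^ i) ` {..n})"
  have W: "f ^ i \<in> W" if "i \<le> n" for i
    unfolding W_def using that by (intro lin_span_base[OF B]) auto
  have top: "f * f ^ n \<in> W"
  proof (cases "f = 0")
    case True then show ?thesis unfolding W_def using lin_span.zero by simp
  next
    case False
    have "f * f ^ n = poly p (inverse f) * f ^ n" using p(1) by simp
    also have "\<dots> = (\<Sum>i\<le>n. Polynomial.coeff p i * (inverse f ^ i * f ^ n))"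
      unfolding poly_altdef n_def sum_distrib_right by (simp add: mult.assoc)
    also have "\<dots> = (\<Sum>i\<le>n. Polynomial.coeff p i * f ^ (n - i))"
      using False by (intro sum.cong) (auto simp: power_diff power_inverse field_simps)
    also have "\<dots> \<in> W" unfolding W_def
      by (intro lin_span_sum lin_span_scale[OF B]) (use p(2) W in \<open>auto simp: W_def\<close>)
    finally show ?thesis .
  qed
  have step: "f * g \<in> W" if "g \<in> W" for g
    using that unfolding W_def
  proof (rule lin_span_mult[OF B, rotated])
    fix b assume "b \<in> (\<lambda>i. f ^ i) ` {..n}"
    then obtain i where i: "i \<le> n" "b = f ^ i" by blast
    have "f * f ^ i \<in> W" if "i < n" using W[of "Suc i"] that by simp
    then show "f * b \<in> lin_span B ((\<lambda>i. f ^ i) ` {..n})"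
      using i top unfolding W_def by (cases "i = n") auto
  qed
  have "f ^ k \<in> W" for k by (induction k) (use W[of 0] step in auto)
  then show ?thesis unfolding W_def by blast
qed

lemma ideal_minus:
  "is_subring A \<Longrightarrow> is_ideal_of A I \<Longrightarrow> a \<in> I \<Longrightarrow> - a \<in> I"
  using subring_minus[of A 1] subring_one[of A] unfolding is_ideal_of_def by (metis mult_minus1)

lemma ideal_add: "is_ideal_of A I \<Longrightarrow> a \<in> I \<Longrightarrow> b \<in> I \<Longrightarrow> a + b \<in> I"
  unfolding is_ideal_of_def by blast

lemma ideal_diff:
  "is_subring A \<Longrightarrow> is_ideal_of A I \<Longrightarrow> a \<in> I \<Longrightarrow> b \<in> I \<Longrightarrow> a - b \<in> I"
  using ideal_add[of A I a "- b"] ideal_minus by fastforce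

lemma ideal_mult: "is_ideal_of A I \<Longrightarrow> r \<in> A \<Longrightarrow> a \<in> I \<Longrightarrow> r * a \<in> I"
  unfolding is_ideal_of_def by blast

lemma ideal_power:
  assumes "is_subring A" "is_ideal_of A I" "a \<in> I" "n > 0" shows "a ^ n \<in> I"
proof -
  have "a \<in> A" using assms unfolding is_ideal_of_def by blast
  then have "a ^ (n - 1) * a \<in> I" using ideal_mult assms subring_power by blast
  then show ?thesis using assms(4) by (simp add: power_eq_if mult.commute)
qed

lemma principal_ideal:
  assumes "is_subring A" "b \<in> A" shows "is_ideal_of A ((\<lambda>a. b * a) ` A)"
  unfolding is_ideal_of_def
proof (intro conjI ballI)
  show "(\<lambda>a. b * a) ` A \<subseteq> A" using subring_mult[OF assms(1,2)] by blast
  show "0 \<in> (\<lambda>a. b * a) ` A" using subring_zero[OF assms(1)] by force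
next
  fix u v assume "u \<in> (\<lambda>a. b * a) ` A" "v \<in> (\<lambda>a. b * a) ` A"
  then obtain u' v' where "u = b * u'" "v = b * v'" "u' \<in> A" "v' \<in> A" by blast
  then show "u + v \<in> (\<lambda>a. b * a) ` A"
    by (intro image_eqI[of _ _ "u' + v'"]) (auto simp: distrib_left subring_add[OF assms(1)])
next
  fix r u assume "u \<in> (\<lambda>a. b * a) ` A" "r \<in> A"
  then obtain u' where "u = b * u'" "u' \<in> A" by blast
  then show "r * u \<in> (\<lambda>a. b * a) ` A"
    by (intro image_eqI[of _ _ "r * u'"]) (auto simp: subring_mult[OF assms(1) \<open>r \<in> A\<close>])
qed

section \<open>Finite constant fields and the Frobenius map\<close>

text \<open>
  The translation \<open>a \<mapsto> a + 1\<close> permutes \<open>K\<close> and hence preserves the sum of all elements.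
\<close>

lemma finite_subfield_card_eq_zero:
  fixes K :: "'a::field set"
  assumes K: "is_subfield K" and fin: "finite K"
  shows "of_nat (card K) = (0::'a)"
proof -
  note R = subfield_imp_subring[OF K]
  have "(\<Sum>a\<in>K. a + 1) = (\<Sum>a\<in>K. a)"
    by (rule sum.reindex_bij_witness[of _ "\<lambda>a. a - 1" "\<lambda>a. a + 1"])
      (auto intro: subring_add[OF R] subring_diff[OF R] subring_one[OF R])
  then show ?thesis by (simp add: sum.distrib)
qed

lemma finite_subfield_power_card:
  fixes K :: "'a::field set"
  assumes K: "is_subfield K" and fin: "finite K" and c: "c \<in> K"
  shows "c ^ card K = c"
proof (cases "c = 0")
  case True
  have "card K \<noteq> 0" using fin c by auto
  then show ?thesis using True by simp
next
  case False
  note R = subfield_imp_subring[OF K]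
  have ic: "inverse c \<in> K" using K c unfolding is_subfield_def by blast
  have "(\<Prod>a\<in>K-{0}. c * a) = (\<Prod>a\<in>K-{0}. a)"
    by (rule prod.reindex_bij_witness[of _ "\<lambda>a. inverse c * a" "\<lambda>a. c * a"])
      (use False c ic in \<open>auto intro: subring_mult[OF R] simp flip: mult.assoc\<close>)
  moreover have "(\<Prod>a\<in>K-{0}. a) \<noteq> 0" using fin by simp
  ultimately have "c ^ card (K - {0}) = 1" by (simp add: prod.distrib)
  moreover have "card K = Suc (card (K - {0}))"
    using fin subring_zero[OF R] by (metis card_Suc_Diff1)
  ultimately show ?thesis by simp
qed

context
  assumes char3: "(3::'a::field) = 0"
begin

lemma frobenius_add: "((a::'a) + b) ^ (3 ^ n) = a ^ (3 ^ n) + b ^ (3 ^ n)"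
proof (induction n)
  case (Suc n)
  have cube: "((a::'a) + b) ^ 3 = a ^ 3 + b ^ 3" for a b
  proof -
    have "(a + b) ^ 3 = a ^ 3 + b ^ 3 + 3 * (a ^ 2 * b + a * b ^ 2)"
      by (simp add: power2_eq_square power3_eq_cube algebra_simps)
    then show ?thesis using char3 by simp
  qed
  have "(a + b) ^ (3 ^ Suc n) = ((a + b) ^ (3 ^ n)) ^ 3" by (simp add: mult.commute flip: power_mult)
  also have "\<dots> = (a ^ (3 ^ n)) ^ 3 + (b ^ (3 ^ n)) ^ 3" using Suc cube by simp
  finally show ?case by (simp add: mult.commute flip: power_mult)
qed simp

lemma frobenius_diff: "((a::'a) - b) ^ (3 ^ n) = a ^ (3 ^ n) - b ^ (3 ^ n)"
  using frobenius_add[of a "- b" n] by simp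

lemma frobenius_sum: "(\<Sum>i\<in>I. g i :: 'a) ^ (3 ^ n) = (\<Sum>i\<in>I. g i ^ (3 ^ n))"
  by (induction I rule: infinite_finite_induct) (auto simp: frobenius_add)

end

section \<open>The coordinate ring and its places at infinity\<close>

locale curve =
  fixes K :: "'a::field set" and x y :: 'a and q t :: nat
  assumes t: "t \<ge> 1" and q: "q = 3 ^ t"
    and K: "is_subfield K" and cardK: "card K = q ^ 2"
    and gen: "field_adjoin K {x, y} = UNIV"
    and curve_eq: "x ^ q + x + (\<Sum>i<t. y ^ (3 ^ i)) ^ 2 = 0"
begin

text \<open>
  The choice of \<open>z\<close> is the heart of the matter. At a pole of \<open>y\<close> the curve equation forces
  \<open>x\<^sup>3\<close> and \<open>- y\<^sup>2\<close> to have the same leading term, and for \<open>q > 3\<close> the sum \<open>x\<^sup>3 + y\<^sup>2\<close> in turn has the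
  leading term of \<open>x\<^sup>2\<close>. Removing that as well leaves a function of pole order \<open>q + 1\<close>; for \<open>q = 3\<close> one
  simply has \<open>z = - x - x\<^sup>2\<close>, of pole order 4. Since \<open>y\<close> has pole order \<open>q\<close>, the quotient \<open>s\<close> vanishes
  to order 1.
\<close>

definition w :: nat where "w = 3 ^ (t - 1)"
definition T :: 'a where "T = (\<Sum>i<t. y ^ (3 ^ i))"
definition z :: 'a where "z = x ^ 3 + y ^ 2 - x ^ 2"
definition s :: 'a where "s = y / z"
definition A :: "'a set" where "A = is_subring hull (K \<union> {x, y})"
definition at_inf :: "'a set \<Rightarrow> bool" where "at_inf R \<longleftrightarrow> valuation_ring K R \<and> y \<notin> R"

lemma q_w: "q = 3 * w" unfolding q w_def using t by (cases t) auto

lemma w_pos: "w > 0" unfolding w_def by simp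

lemma q_ge_3: "q \<ge> 3" using q_w w_pos by simp

lemma finK: "finite K"
  using cardK q_ge_3 by (metis card.infinite not_numeral_le_zero power_not_zero)

lemma char3: "(3::'a) = 0"
proof -
  have "(of_nat (q ^ 2) :: 'a) = 0" using finite_subfield_card_eq_zero[OF K finK] cardK by simp
  then show ?thesis unfolding q by (simp add: power_mult[symmetric])
qed

lemmas frob = frobenius_add[OF char3] frobenius_diff[OF char3]

lemma frob_q: "(a + b) ^ q = a ^ q + b ^ q" "(a - b) ^ q = a ^ q - b ^ q" for a b :: 'a
  unfolding q by (rule frob)+

lemma frob_w: "(a + b) ^ w = a ^ w + b ^ w" "(a - b) ^ w = a ^ w - b ^ w" for a b :: 'a
  unfolding w_def by (rule frob)+

lemma xq: "x ^ q = - x - T ^ 2"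
  using curve_eq unfolding T_def by (simp add: eq_neg_iff_add_eq_0 algebra_simps)

text \<open>
  Cubing shifts the summands of \<open>T\<close>, so that \<open>T\<^sup>3 - T\<close> telescopes.
\<close>

lemma yq: "y ^ q = T ^ 3 - T + y"
proof -
  have "T ^ (3 ^ 1) = (\<Sum>i<t. y ^ (3 ^ Suc i))"
    unfolding T_def frobenius_sum[OF char3] by (simp add: mult.commute flip: power_mult)
  moreover have "(\<Sum>i<t. y ^ (3 ^ Suc i)) + y ^ (3 ^ 0) = T + y ^ (3 ^ t)"
    unfolding T_def using sum.lessThan_Suc_shift[of "\<lambda>i. y ^ (3 ^ i)" t] by (simp add: add.commute)
  ultimately show ?thesis unfolding q by (simp add: algebra_simps)
qed

text \<open>
  Expand \<open>z\<^sup>q = (x\<^sup>q)\<^sup>3 + (y\<^sup>q)\<^sup>2 - (x\<^sup>q)\<^sup>2\<close>. All terms of degree 4 and more in \<open>T\<close> cancel or have a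
  coefficient divisible by 3, and \<open>- T\<^sup>3 y\<close> becomes the dominant one.
\<close>

lemma zq: "z ^ q = - (T ^ 3 * y) + (T ^ 2 + T * y + x * T ^ 2 + y ^ 2 - x ^ 2 - x ^ 3)"
proof -
  have "z ^ q = (x ^ q) ^ 3 + (y ^ q) ^ 2 - (x ^ q) ^ 2"
    unfolding z_def frob_q by (simp add: mult.commute flip: power_mult)
  also have "\<dots> = (- x - T ^ 2) ^ 3 + (T ^ 3 - T + y) ^ 2 - (- x - T ^ 2) ^ 2" unfolding xq yq ..
  also have "\<dots> = - (T ^ 3 * y) + (T ^ 2 + T * y + x * T ^ 2 + y ^ 2 - x ^ 2 - x ^ 3)
      + 3 * (T ^ 3 * y - x ^ 2 * T ^ 2 - x * T ^ 4 - T ^ 4 - T * y - x * T ^ 2)"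
    by (simp add: power2_eq_square power3_eq_cube power4_eq_xxxx algebra_simps)
  finally show ?thesis unfolding char3 by simp
qed

text \<open>
  This relation lowers the exponent of \<open>z\<close> below \<open>w\<close> and thereby bounds the set of monomials needed to
  span the coordinate ring.
\<close>

lemma zw: "z ^ w = y ^ (2 * w) - x ^ (2 * w) - x - T ^ 2"
proof -
  have "z ^ w = (x ^ 3) ^ w + (y ^ 2) ^ w - (x ^ 2) ^ w" unfolding z_def frob_w ..
  then show ?thesis using xq unfolding q_w by (simp flip: power_mult)
qed

subsection \<open>Leading terms at infinity\<close>

text \<open>
  Nothing is known at first about the valuation of a ring without \<open>y\<close>, not even that it is discrete.
  Orders are therefore compared through congruences modulo the maximal ideal: \<open>f s\<^sup>n \<equiv> c\<close> with a nonzero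
  constant \<open>c\<close> says that \<open>f\<close> has a pole of order \<open>n\<close> in units of \<open>s\<close>.
\<close>

context
  fixes R assumes inf: "at_inf R"
begin

lemma val: "valuation_ring K R" using inf unfolding at_inf_def by blast

lemmas Rring = val_subring[OF val]

lemma y_nz: "y \<noteq> 0" using inf subring_zero[OF Rring] unfolding at_inf_def by blast

lemma inverse_y: "inverse y \<in> nonunits R"
  using inf inverse_nonunit[OF val] unfolding at_inf_def by blast

lemma minus_one_in: "- 1 \<in> R" using subring_minus[OF Rring subring_one[OF Rring]] .

lemma cong_minus_one_unit: "a + 1 \<in> nonunits R \<Longrightarrow> unit_in R a"
  using cong_unit[OF val, of "- 1" a] minus_one_in unfolding unit_in_def by simp

lemma T_lead: "T * inverse y ^ w - 1 \<in> nonunits R"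
proof -
  define u where "u = t - 1"
  have u: "t = Suc u" using t unfolding u_def by simp
  have wu: "w = 3 ^ u" unfolding w_def u_def ..
  have "y ^ (3 ^ i) * inverse y ^ w \<in> nonunits R" if "i < u" for i
  proof -
    have lt: "3 ^ i < w" unfolding wu using that by simp
    have "inverse y ^ w = inverse y ^ (w - 3 ^ i) * inverse y ^ (3 ^ i)"
      using lt by (simp flip: power_add)
    then have "y ^ (3 ^ i) * inverse y ^ w = inverse y ^ (w - 3 ^ i)"
      using y_nz by (simp add: power_inverse)
    then show ?thesis using nonunits_power[OF val inverse_y] lt by simp
  qed
  then have "(\<Sum>i<u. y ^ (3 ^ i) * inverse y ^ w) \<in> nonunits R"
    by (intro nonunits_sum[OF val]) auto
  moreover have "y ^ w * inverse y ^ w = 1" using y_nz by (simp add: power_inverse)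
  moreover have "T = (\<Sum>i<u. y ^ (3 ^ i)) + y ^ w" unfolding T_def wu by (simp add: u)
  ultimately show ?thesis by (simp add: sum_distrib_right distrib_right)
qed

lemma theta_in: "T * inverse y ^ w \<in> R"
  using subring_add[OF Rring nonunits_subset[OF val T_lead] subring_one[OF Rring]] by simp

text \<open>
  The term \<open>x\<close> is negligible against \<open>T\<^sup>2\<close> in \<open>x\<^sup>q = - x - T\<^sup>2\<close>. Otherwise \<open>T\<^sup>2 / x\<close> would be regular,
  hence also \<open>x\<^sup>q\<^sup>-\<^sup>1\<close> and \<open>x\<close>, and then \<open>x\<close> would be negligible after all.
\<close>

lemma x_small: "x * inverse y ^ (2 * w) \<in> nonunits R"
proof (cases "x \<in> R")
  case True
  then show ?thesis
    using nonunits_mult2[OF val _ nonunits_power[OF val inverse_y]] w_pos by simp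
next
  case False
  define v where "v = x * inverse y ^ (2 * w)"
  have x0: "x \<noteq> 0" using False subring_zero[OF Rring] by blast
  have v0: "v \<noteq> 0" unfolding v_def using x0 y_nz by simp
  define \<theta> where "\<theta> = (T * inverse y ^ w) ^ 2"
  have "x * (x ^ (q - 1)) = - x - T ^ 2" using xq q_ge_3 by (metis power_eq_if not_numeral_le_zero)
  then have "v * x ^ (q - 1) = (- x - T ^ 2) * inverse y ^ (2 * w)"
    unfolding v_def by (metis mult.assoc mult.commute)
  also have "\<dots> = - v - \<theta>"
    unfolding v_def \<theta>_def by (simp add: power_mult_distrib algebra_simps flip: power_mult)
  finally have "x ^ (q - 1) = - 1 - \<theta> * inverse v" using v0 by (simp add: field_simps)
  moreover have "x ^ (q - 1) \<notin> R" using val_power_imp[OF val] False q_ge_3 by auto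
  moreover have "\<theta> \<in> R" unfolding \<theta>_def using subring_power[OF Rring theta_in] .
  ultimately have "inverse v \<notin> R"
    using subring_diff[OF Rring minus_one_in subring_mult[OF Rring]] by metis
  then have "inverse (inverse v) \<in> nonunits R" by (rule inverse_nonunit[OF val])
  then show ?thesis unfolding v_def by simp
qed

text \<open>
  The \<open>w\<close>-th power of the left side is given by the curve equation; the Frobenius map extracts the root.
\<close>

lemma x3_lead: "x ^ 3 * inverse y ^ 2 + 1 \<in> nonunits R"
proof -
  have "(x ^ 3 * inverse y ^ 2 + 1) ^ w = x ^ q * inverse y ^ (2 * w) + 1"
    unfolding frob_w q_w power_mult_distrib by (simp flip: power_mult)
  also have "\<dots> = - (x * inverse y ^ (2 * w)) - ((T * inverse y ^ w) ^ 2 - 1 ^ 2)"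
    unfolding xq by (simp add: power_mult_distrib algebra_simps flip: power_mult)
  also have "\<dots> \<in> nonunits R"
    by (rule nonunits_diff[OF val nonunits_minus[OF val x_small] cong_power[OF val T_lead subring_one[OF Rring]]])
  finally show ?thesis using nonunits_power_imp[OF val] w_pos by blast
qed

lemma xi_in: "x ^ 3 * inverse y ^ 2 \<in> R"
  using cong_minus_one_unit[OF x3_lead] unfolding unit_in_def by blast

text \<open>
  Twice the order of \<open>y\<close> is three times that of \<open>x\<close>, as one sees on taking cubes.
\<close>

lemma x_pow_small:
  assumes "2 * n < 3 * m" shows "x ^ n * inverse y ^ m \<in> nonunits R"
proof -
  have "inverse y ^ (3 * m) = inverse y ^ (2 * n) * inverse y ^ (3 * m - 2 * n)"
    using assms by (simp flip: power_add)
  then have "(x ^ n * inverse y ^ m) ^ 3 = (x ^ 3 * inverse y ^ 2) ^ n * inverse y ^ (3 * m - 2 * n)"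
    by (simp add: power_mult_distrib power_mult[symmetric] mult.commute[of 3] mult.assoc)
  then have "(x ^ n * inverse y ^ m) ^ 3 \<in> nonunits R"
    using nonunits_mult2[OF val subring_power[OF Rring xi_in] nonunits_power[OF val inverse_y]] assms by simp
  then show ?thesis using nonunits_power_imp[OF val] by simp
qed

lemma zq_lead: "z ^ q * inverse y ^ (q + 1) + 1 \<in> nonunits R"
proof -
  define Y where "Y = inverse y"
  define \<theta> where "\<theta> = T * Y ^ w"
  have yY: "y * Y = 1" unfolding Y_def using y_nz by simp
  have qs: "Y ^ (q + 1) = Y ^ (3 * w) * Y" unfolding q_w by simp
  have e1: "T ^ 3 * y * Y ^ (q + 1) = \<theta> ^ 3"
  proof -
    have "T ^ 3 * y * Y ^ (q + 1) = T ^ 3 * Y ^ (3 * w) * (y * Y)" unfolding qs by (simp add: mult_ac)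
    then show ?thesis unfolding yY \<theta>_def by (simp add: power_mult_distrib mult.commute flip: power_mult)
  qed
  have e2: "T ^ 2 * Y ^ (q + 1) = \<theta> ^ 2 * Y ^ (w + 1)"
  proof -
    have "Y ^ (q + 1) = Y ^ (w * 2) * Y ^ (w + 1)" unfolding q_w by (simp flip: power_add)
    then show ?thesis unfolding \<theta>_def by (simp only: power_mult_distrib power_mult mult_ac)
  qed
  have e3: "T * y * Y ^ (q + 1) = \<theta> * Y ^ (2 * w)"
  proof -
    have "q + 1 = w + 2 * w + 1" using q_w by simp
    then have "Y ^ (q + 1) = Y ^ w * Y ^ (2 * w) * Y" by (simp only: power_add power_one_right)
    then have "T * y * Y ^ (q + 1) = T * y * (Y ^ w * Y ^ (2 * w) * Y)" by (simp only:)
    also have "\<dots> = T * Y ^ w * Y ^ (2 * w) * (y * Y)" by (simp only: mult_ac)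
    finally have "T * y * Y ^ (q + 1) = T * Y ^ w * Y ^ (2 * w) * (y * Y)" .
    then show ?thesis unfolding yY \<theta>_def by simp
  qed
  have e4: "x * T ^ 2 * Y ^ (q + 1) = \<theta> ^ 2 * (x ^ 1 * Y ^ (w + 1))"
  proof -
    have "x * T ^ 2 * Y ^ (q + 1) = x * (T ^ 2 * Y ^ (q + 1))" by (simp only: mult.assoc)
    also have "\<dots> = x * (\<theta> ^ 2 * Y ^ (w + 1))" by (simp only: e2)
    finally show ?thesis by (simp only: mult_ac power_one_right)
  qed
  have e5: "y ^ 2 * Y ^ (q + 1) = Y ^ (q - 1)"
  proof -
    have "q + 1 = 2 + (q - 1)" using q_ge_3 by simp
    then have "Y ^ (q + 1) = Y ^ 2 * Y ^ (q - 1)" by (simp only: power_add)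
    then have "y ^ 2 * Y ^ (q + 1) = (y * Y) ^ 2 * Y ^ (q - 1)"
      by (simp only: power_mult_distrib mult.assoc)
    then show ?thesis using yY by simp
  qed
  have \<theta>1: "\<theta> - 1 \<in> nonunits R" using T_lead unfolding \<theta>_def Y_def .
  have \<theta>R: "\<theta> \<in> R" using theta_in unfolding \<theta>_def Y_def .
  have Yn: "Y ^ n \<in> nonunits R" if "n > 0" for n
    using nonunits_power[OF val inverse_y that] unfolding Y_def .
  have xn: "x ^ n * Y ^ m \<in> nonunits R" if "2 * n < 3 * m" for n m
    using x_pow_small[OF that] unfolding Y_def .
  have "z ^ q * Y ^ (q + 1) + 1 = - (\<theta> ^ 3 - 1 ^ 3) +
      (\<theta> ^ 2 * Y ^ (w + 1) + \<theta> * Y ^ (2 * w) + \<theta> ^ 2 * (x ^ 1 * Y ^ (w + 1)) + Y ^ (q - 1)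
       - x ^ 2 * Y ^ (q + 1) - x ^ 3 * Y ^ (q + 1))"
    unfolding zq e1[symmetric] e2[symmetric] e3[symmetric] e4[symmetric] e5[symmetric]
    by (simp only: ring_distribs) simp
  also have "\<dots> \<in> nonunits R"
    by (intro nonunits_add[OF val] nonunits_diff[OF val] nonunits_minus[OF val]
        cong_power[OF val \<theta>1] subring_one[OF Rring] nonunits_mult2[OF val] subring_power[OF Rring]
        \<theta>R Yn xn) (use w_pos q_ge_3 in auto)
  finally show ?thesis unfolding Y_def .
qed

lemma z_nz: "z \<noteq> 0"
  using zq_lead one_notin_nonunits[OF val] q_ge_3 by (auto simp: power_0_left)

lemma s_nz: "s \<noteq> 0" unfolding s_def using y_nz z_nz by simp

text \<open>
  By \<open>zq_lead\<close>, \<open>z\<^sup>q\<close> and \<open>- y\<^sup>q\<^sup>+\<^sup>1\<close> have the same leading term, so \<open>s\<^sup>q = y\<^sup>q / z\<^sup>q\<close> behaves like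
  \<open>- 1 / y\<close>.
\<close>

lemma y_lead: "y * s ^ q + 1 \<in> nonunits R"
proof -
  define \<zeta> where "\<zeta> = z ^ q * inverse y ^ (q + 1)"
  have z1: "\<zeta> + 1 \<in> nonunits R" using zq_lead unfolding \<zeta>_def .
  have zu: "unit_in R \<zeta>" by (rule cong_minus_one_unit[OF z1])
  have "y * s ^ q = inverse \<zeta>"
    unfolding s_def \<zeta>_def using y_nz z_nz by (simp add: power_divide field_simps)
  then have "y * s ^ q + 1 = inverse \<zeta> * (\<zeta> + 1)" using zu unfolding unit_in_def by (simp add: field_simps)
  then show ?thesis using nonunits_mult2[OF val _ z1] zu unfolding unit_in_def by simp
qed

lemma z_lead: "z * s ^ (q + 1) + 1 \<in> nonunits R"
proof -
  have "z * s = y" unfolding s_def using z_nz by simp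
  then have "z * s ^ (q + 1) = y * s ^ q" by (metis Suc_eq_plus1 mult.assoc power_Suc)
  then show ?thesis using y_lead by (simp only:)
qed

lemma x_lead: "x * s ^ (2 * w) + 1 \<in> nonunits R"
proof -
  have 1: "x ^ 3 * inverse y ^ 2 - (- 1) \<in> nonunits R" "y * s ^ q - (- 1) \<in> nonunits R"
    using x3_lead y_lead by simp_all
  have yy: "inverse y ^ 2 * y ^ 2 = 1" using y_nz by (simp add: power_inverse)
  have "(x * s ^ (2 * w)) ^ 3 = x ^ 3 * (s ^ q) ^ 2"
    unfolding q_w by (simp add: power_mult_distrib flip: power_mult)
  also have "\<dots> = (x ^ 3 * inverse y ^ 2) * (y * s ^ q) ^ 2"
    using yy by (simp add: power_mult_distrib mult_ac)
  finally have "(x * s ^ (2 * w)) ^ 3 - (- 1) * (- 1) ^ 2 \<in> nonunits R"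
    using cong_mult[OF val 1(1) cong_power[OF val 1(2), of 2]] minus_one_in
      subring_power[OF Rring minus_one_in] subring_one[OF Rring] by simp
  then have "(x * s ^ (2 * w) + 1) ^ (3 ^ 1) \<in> nonunits R"
    unfolding frobenius_add[OF char3] by simp
  then show ?thesis using nonunits_power_imp[OF val] by simp
qed

lemma s_nonunit: "s \<in> nonunits R"
proof -
  have "s ^ q = (y * s ^ q) * inverse y" using y_nz by simp
  then have "s ^ q \<in> nonunits R"
    using nonunits_mult2[OF val _ inverse_y] cong_minus_one_unit[OF y_lead] unfolding unit_in_def by metis
  then show ?thesis using nonunits_power_imp[OF val] q_ge_3 by simp
qed

end

text \<open>
  The triple \<open>(i, j, k)\<close> stands for the monomial \<open>x\<^sup>i y\<^sup>j z\<^sup>k\<close>; \<open>wt\<close> is its pole order at infinity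
  and \<open>sg\<close> its leading coefficient with respect to \<open>s\<close>.
\<close>

definition mon :: "nat \<times> nat \<times> nat \<Rightarrow> 'a" where
  "mon = (\<lambda>(i, j, k). x ^ i * y ^ j * z ^ k)"

definition wt :: "nat \<times> nat \<times> nat \<Rightarrow> nat" where
  "wt = (\<lambda>(i, j, k). 2 * w * i + q * j + (q + 1) * k)"

definition sg :: "nat \<times> nat \<times> nat \<Rightarrow> 'a" where
  "sg = (\<lambda>(i, j, k). (- 1) ^ i * (- 1) ^ j * (- 1) ^ k)"

lemma mon_lead:
  assumes "at_inf R" shows "mon \<tau> * s ^ wt \<tau> - sg \<tau> \<in> nonunits R"
proof -
  obtain i j k where \<tau>: "\<tau> = (i, j, k)" by (cases \<tau>) auto
  note v = val[OF assms] and m1 = minus_one_in[OF assms]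
  have 1: "x * s ^ (2 * w) - (- 1) \<in> nonunits R" "y * s ^ q - (- 1) \<in> nonunits R"
    "z * s ^ (q + 1) - (- 1) \<in> nonunits R"
    using x_lead y_lead z_lead assms by simp_all
  have "s ^ wt \<tau> = (s ^ (2 * w)) ^ i * (s ^ q) ^ j * (s ^ (q + 1)) ^ k"
    unfolding \<tau> wt_def prod.case by (simp only: power_add power_mult)
  then have "mon \<tau> * s ^ wt \<tau> = (x * s ^ (2 * w)) ^ i * (y * s ^ q) ^ j * (z * s ^ (q + 1)) ^ k"
    unfolding \<tau> mon_def prod.case by (simp only: power_mult_distrib mult_ac)
  then show ?thesis unfolding \<tau> sg_def prod.case
    using cong_mult[OF v cong_mult[OF v cong_power[OF v 1(1)] cong_power[OF v 1(2)]] cong_power[OF v 1(3)]]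
      m1 subring_power[OF val_subring[OF v] m1] subring_mult[OF val_subring[OF v]] by simp
qed

lemmas Kring = subfield_imp_subring[OF K]

lemma A_subring: "is_subring A"
proof -
  have "is_subring (\<Inter>C)" if "\<forall>R\<in>C. is_subring R" for C :: "'a set set"
    using that unfolding is_subring_def by blast
  then show ?thesis unfolding A_def by (rule hull_in)
qed

lemma A_gens: "c \<in> K \<Longrightarrow> c \<in> A" "x \<in> A" "y \<in> A"
  unfolding A_def using hull_subset[of "K \<union> {x, y}" is_subring] by blast+

lemma z_in_A: "z \<in> A"
  unfolding z_def by (intro subring_diff subring_add subring_power A_subring A_gens)

lemma A_minimal: "is_subring B \<Longrightarrow> K \<subseteq> B \<Longrightarrow> x \<in> B \<Longrightarrow> y \<in> B \<Longrightarrow> A \<subseteq> B"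
  unfolding A_def by (rule hull_minimal) auto

lemma fraction: "\<exists>a\<in>A. \<exists>b\<in>A. b \<noteq> 0 \<and> f = a / b"
proof -
  note R = A_subring
  define F where "F = {a / b | a b. a \<in> A \<and> b \<in> A \<and> b \<noteq> 0}"
  have FI: "a / b \<in> F" if "a \<in> A" "b \<in> A" "b \<noteq> 0" for a b using that unfolding F_def by blast
  have FA: "a \<in> F" if "a \<in> A" for a using FI[OF that subring_one[OF R]] by simp
  have "is_subfield F" unfolding is_subfield_def
  proof (intro conjI ballI)
    show "1 \<in> F" using FA subring_one[OF R] .
    fix u assume "u \<in> F"
    then obtain a b where u: "u = a / b" "a \<in> A" "b \<in> A" "b \<noteq> 0" unfolding F_def by blast
    show "inverse u \<in> F"
    proof (cases "a = 0")
      case True then show ?thesis using u FA subring_zero[OF R] by simp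
    next
      case False then show ?thesis using u FI[of b a] by simp
    qed
    fix v assume "v \<in> F"
    then obtain c d where v: "v = c / d" "c \<in> A" "d \<in> A" "d \<noteq> 0" unfolding F_def by blast
    have "u - v = (a * d - c * b) / (b * d)" "u * v = (a * c) / (b * d)"
      using u v by (simp_all add: field_simps)
    then show "u - v \<in> F" "u * v \<in> F"
      using u v by (auto intro!: FI subring_diff[OF R] subring_mult[OF R])
  qed
  moreover have "K \<union> {x, y} \<subseteq> F" using FA A_gens by blast
  ultimately have "field_adjoin K {x, y} \<subseteq> F" unfolding field_adjoin_def by (rule hull_minimal[rotated])
  then show ?thesis using gen unfolding F_def by blast
qed

subsection \<open>A spanning set of monomials with distinct weights\<close>

text \<open>
  In the \<open>K[y]\<close>-module \<open>K[x, y]\<close> the product \<open>x\<^sup>i z\<^sup>k\<close> is a monic polynomial in \<open>x\<close> of degree \<open>3 k + i\<close>.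
  The span below therefore consists of the polynomials of degree less than \<open>d\<close> in \<open>x\<close>.
\<close>

definition monomial_span :: "nat \<Rightarrow> 'a set" where
  "monomial_span d = lin_span K (mon ` {(i, j, k). i < 3 \<and> 3 * k + i < d})"

lemma monomial_span_mon: "i < 3 \<Longrightarrow> 3 * k + i < d \<Longrightarrow> x ^ i * y ^ j * z ^ k \<in> monomial_span d"
  unfolding monomial_span_def by (rule lin_span_base[OF Kring]) (auto simp: mon_def intro!: image_eqI[of _ _ "(i, j, k)"])

lemma monomial_span_mono: "d \<le> d' \<Longrightarrow> f \<in> monomial_span d \<Longrightarrow> f \<in> monomial_span d'"
  unfolding monomial_span_def by (erule lin_span_mono[rotated]) auto

lemma monomial_span_add: "f \<in> monomial_span d \<Longrightarrow> g \<in> monomial_span d \<Longrightarrow> f + g \<in> monomial_span d"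
  unfolding monomial_span_def by (rule lin_span_add)

lemma monomial_span_diff: "f \<in> monomial_span d \<Longrightarrow> g \<in> monomial_span d \<Longrightarrow> f - g \<in> monomial_span d"
  using lin_span_add[OF _ lin_span_minus[OF Kring]] unfolding monomial_span_def by fastforce

lemma monomial_span_mult:
  assumes "\<And>i j k. i < 3 \<Longrightarrow> 3 * k + i < d \<Longrightarrow> h * (x ^ i * y ^ j * z ^ k) \<in> monomial_span d'" "f \<in> monomial_span d"
  shows "h * f \<in> monomial_span d'"
  using assms(2) unfolding monomial_span_def
  by (rule lin_span_mult[OF Kring, rotated]) (use assms(1) in \<open>auto simp: mon_def monomial_span_def\<close>)

lemma monomial_span_y: "f \<in> monomial_span d \<Longrightarrow> y ^ n * f \<in> monomial_span d"
proof (rule monomial_span_mult)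
  fix i j k :: nat assume "i < 3" "3 * k + i < d"
  from monomial_span_mon[OF this, of "n + j"] show "y ^ n * (x ^ i * y ^ j * z ^ k) \<in> monomial_span d"
    by (simp add: power_add mult_ac)
qed

lemma monomial_span_T: "f \<in> monomial_span d \<Longrightarrow> T * f \<in> monomial_span d"
  unfolding T_def sum_distrib_right using monomial_span_y unfolding monomial_span_def by (intro lin_span_sum)

lemma x3: "x ^ 3 = z - y ^ 2 + x ^ 2" unfolding z_def by simp

lemma x_reduce: "x * (x ^ 2 * y ^ j * z ^ k) =
    x ^ 0 * y ^ j * z ^ (k + 1) - x ^ 0 * y ^ (j + 2) * z ^ k + x ^ 2 * y ^ j * z ^ k"
proof -
  have "x * (x ^ 2 * y ^ j * z ^ k) = x ^ 3 * y ^ j * z ^ k" by (simp add: power2_eq_square power3_eq_cube)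
  also have "\<dots> = (z - y ^ 2 + x ^ 2) * y ^ j * z ^ k" unfolding x3 ..
  finally show ?thesis by (simp add: algebra_simps power2_eq_square)
qed

lemma monomial_span_x_Suc: "f \<in> monomial_span d \<Longrightarrow> x * f \<in> monomial_span (d + 1)"
proof (rule monomial_span_mult)
  fix i j k :: nat assume ik: "i < 3" "3 * k + i < d"
  show "x * (x ^ i * y ^ j * z ^ k) \<in> monomial_span (d + 1)"
  proof (cases "i = 2")
    case True
    show ?thesis unfolding True x_reduce
      by (intro monomial_span_add monomial_span_diff monomial_span_mon) (use ik True in auto)
  next
    case False
    then show ?thesis using monomial_span_mon[of "i + 1" k "d + 1" j] ik by (simp add: mult_ac)
  qed
qed

lemma monomial_span_x_power: "x ^ n \<in> monomial_span (n + 1)"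
  by (induction n) (use monomial_span_mon[of 0 0 1 0] monomial_span_x_Suc in auto)

lemma zw_in_M: "z ^ w \<in> monomial_span q"
proof -
  have 1: "1 \<in> monomial_span q" using monomial_span_mon[of 0 0 q 0] q_ge_3 by simp
  have "x ^ (2 * w) \<in> monomial_span q" using monomial_span_mono[OF _ monomial_span_x_power[of "2 * w"]] q_w w_pos by simp
  moreover have "x \<in> monomial_span q" using monomial_span_mono[OF _ monomial_span_x_power[of 1]] q_ge_3 by simp
  moreover have "y ^ (2 * w) * 1 \<in> monomial_span q" "T * (T * 1) \<in> monomial_span q" using 1 monomial_span_y monomial_span_T by blast+
  ultimately show ?thesis unfolding zw by (auto intro!: monomial_span_diff simp: power2_eq_square)
qed

text \<open>
  For \<open>d = q\<close> the curve equation, in the form \<open>zw\<close>, closes the module under multiplication by \<open>x\<close>.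
\<close>

lemma monomial_span_x: "f \<in> monomial_span q \<Longrightarrow> x * f \<in> monomial_span q"
proof (rule monomial_span_mult)
  fix i j k :: nat assume ik: "i < 3" "3 * k + i < q"
  show "x * (x ^ i * y ^ j * z ^ k) \<in> monomial_span q"
  proof (cases "i = 2")
    case True
    have "x ^ 0 * y ^ j * z ^ (k + 1) \<in> monomial_span q"
    proof (cases "k + 1 = w")
      case w: True
      show ?thesis unfolding w using monomial_span_y[OF zw_in_M] by simp
    next
      case False
      then show ?thesis using monomial_span_mon[of 0 "k + 1" q j] ik q_w by simp
    qed
    then show ?thesis unfolding True x_reduce
      by (rule monomial_span_add[OF monomial_span_diff[OF _ monomial_span_mon] monomial_span_mon]) (use ik True in auto)
  next
    case False
    then have "3 * k + (i + 1) < q" using ik q_w by presburger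
    then show ?thesis using monomial_span_mon[of "i + 1" k q j] False ik by (simp add: mult_ac)
  qed
qed

text \<open>
  The elements that multiply the module into itself form a ring containing \<open>K\<close>, \<open>x\<close> and \<open>y\<close>.
\<close>

lemma A_subset_monomial_span: "A \<subseteq> monomial_span q"
proof -
  let ?B = "{a. \<forall>f\<in>monomial_span q. a * f \<in> monomial_span q}"
  have "A \<subseteq> ?B"
  proof (rule A_minimal)
    show "is_subring ?B" unfolding is_subring_def by (auto simp: left_diff_distrib mult.assoc intro: monomial_span_diff)
    show "K \<subseteq> ?B" unfolding monomial_span_def using lin_span_scale[OF Kring] by blast
    show "x \<in> ?B" using monomial_span_x by blast
    show "y \<in> ?B" using monomial_span_y[of _ q 1] by simp
  qed
  moreover have "1 \<in> monomial_span q" using monomial_span_mon[of 0 0 q 0] q_ge_3 by simp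
  ultimately show ?thesis by fastforce
qed

text \<open>
  Modulo \<open>w\<close> the weight is \<open>k\<close>, which is less than \<open>w\<close>; then \<open>2 i + 3 j\<close> determines \<open>i\<close> modulo 3.
\<close>

lemma wt_inj: "inj_on wt {(i, j, k). i < 3 \<and> 3 * k + i < q}"
proof (rule inj_onI)
  fix \<sigma> \<tau>
  assume st: "\<sigma> \<in> {(i, j, k). i < 3 \<and> 3 * k + i < q}" "\<tau> \<in> {(i, j, k). i < 3 \<and> 3 * k + i < q}"
    and e': "wt \<sigma> = wt \<tau>"
  obtain i j k i' j' k' where \<sigma>\<tau>: "\<sigma> = (i, j, k)" "\<tau> = (i', j', k')" by (metis prod_cases3)
  have i: "i < 3" "i' < 3" "3 * k + i < q" "3 * k' + i' < q" and e: "wt (i, j, k) = wt (i', j', k')"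
    using st e' \<sigma>\<tau> by auto
  have k: "k < w" "k' < w" using i q_w by auto
  have e1: "w * (2 * i + 3 * j + 3 * k) + k = w * (2 * i' + 3 * j' + 3 * k') + k'"
    using e unfolding wt_def prod.case by (simp add: q_w algebra_simps)
  have "k = (w * (2 * i + 3 * j + 3 * k) + k) mod w" using k by simp
  also have "\<dots> = k'" unfolding e1 using k by simp
  finally have kk: "k = k'" .
  then have "2 * i + 3 * j = 2 * i' + 3 * j'" using e1 w_pos by simp
  then have "i = i'" "j = j'" using i by presburger+
  then show "\<sigma> = \<tau>" using kk \<sigma>\<tau> by simp
qed

text \<open>
  The monomials spanning \<open>A\<close> have distinct weights, so the term of greatest weight cannot be cancelled.
  The weight and the leading coefficient come from the expansion alone and serve all rings at infinity
  at once.
\<close>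

lemma leading_term:
  assumes f: "f \<in> A" "f \<noteq> 0"
  shows "\<exists>\<tau> c. c \<in> K - {0} \<and> (\<forall>R. at_inf R \<longrightarrow> f * s ^ wt \<tau> - c \<in> nonunits R)"
proof -
  let ?I = "{(i, j, k). i < 3 \<and> 3 * k + i < q}"
  obtain V c where V: "finite V" "V \<subseteq> ?I" "\<forall>\<tau>\<in>V. c \<tau> \<in> K - {0}" "f = (\<Sum>\<tau>\<in>V. c \<tau> * mon \<tau>)"
    using lin_span_imp_sum[OF Kring, of f mon ?I] A_subset_monomial_span f(1) unfolding monomial_span_def by blast
  have "V \<noteq> {}" using V(4) f(2) by auto
  then have "Max (wt ` V) \<in> wt ` V" using V(1) by simp
  then obtain \<tau> where \<tau>: "\<tau> \<in> V" "wt \<tau> = Max (wt ` V)" by auto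
  have less: "wt \<sigma> < wt \<tau>" if "\<sigma> \<in> V - {\<tau>}" for \<sigma>
  proof -
    have "wt \<sigma> \<le> wt \<tau>" using \<tau>(2) V(1) that by simp
    moreover have "wt \<sigma> \<noteq> wt \<tau>" using wt_inj V(2) \<tau>(1) that unfolding inj_on_def by blast
    ultimately show ?thesis by simp
  qed
  have sgK: "sg \<tau> \<in> K - {0}" for \<tau>
  proof -
    have "- 1 \<in> K" using subring_minus[OF Kring subring_one[OF Kring]] .
    then show ?thesis unfolding sg_def
      by (cases \<tau>) (auto intro!: subring_mult[OF Kring] subring_power[OF Kring])
  qed
  have "f * s ^ wt \<tau> - c \<tau> * sg \<tau> \<in> nonunits R" if inf: "at_inf R" for R
  proof -
    note v = val[OF inf]
    have cR: "c \<sigma> \<in> R" if "\<sigma> \<in> V" for \<sigma> using V(3) that val_const[OF v] by blast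
    have "f = c \<tau> * mon \<tau> + (\<Sum>\<sigma>\<in>V-{\<tau>}. c \<sigma> * mon \<sigma>)"
      unfolding V(4) using V(1) \<tau>(1) by (simp add: sum.remove)
    then have "f * s ^ wt \<tau> - c \<tau> * sg \<tau> = c \<tau> * (mon \<tau> * s ^ wt \<tau> - sg \<tau>) +
        (\<Sum>\<sigma>\<in>V-{\<tau>}. c \<sigma> * (mon \<sigma> * s ^ wt \<tau>))"
      by (simp add: algebra_simps sum_distrib_left)
    also have "\<dots> \<in> nonunits R"
    proof (rule nonunits_add[OF v nonunits_mult2[OF v cR[OF \<tau>(1)] mon_lead[OF inf]] nonunits_sum[OF v]])
      fix \<sigma> assume \<sigma>: "\<sigma> \<in> V - {\<tau>}"
      have u: "unit_in R (mon \<sigma> * s ^ wt \<sigma>)"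
        using cong_unit[OF v const_unit[OF v K] mon_lead[OF inf]] sgK by blast
      have "s ^ wt \<tau> = s ^ wt \<sigma> * s ^ (wt \<tau> - wt \<sigma>)" using less[OF \<sigma>] by (simp flip: power_add)
      then have "mon \<sigma> * s ^ wt \<tau> = (mon \<sigma> * s ^ wt \<sigma>) * s ^ (wt \<tau> - wt \<sigma>)" by (simp add: mult.assoc)
      also have "\<dots> \<in> nonunits R"
        using u less[OF \<sigma>] unfolding unit_in_def
        by (intro nonunits_mult2[OF v] nonunits_power[OF v] s_nonunit[OF inf]) auto
      finally show "c \<sigma> * (mon \<sigma> * s ^ wt \<tau>) \<in> nonunits R"
        using nonunits_mult2[OF v cR] \<sigma> by blast
    qed
    finally show ?thesis .
  qed
  then show ?thesis using V(3) \<tau>(1) sgK[of \<tau>] subring_mult[OF Kring]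
    by (intro exI[of _ \<tau>] exI[of _ "c \<tau> * sg \<tau>"]) auto
qed

lemma leading_unit:
  assumes "c \<in> K - {0}" "at_inf R" "f * s ^ n - c \<in> nonunits R"
  shows "unit_in R (f * s ^ n)"
  using cong_unit[OF val[OF assms(2)] const_unit[OF val[OF assms(2)] K] assms(3)] assms(1) by blast

lemma order_at_inf:
  assumes "f \<noteq> 0"
  shows "\<exists>n. \<forall>R. at_inf R \<longrightarrow> (\<exists>u. unit_in R u \<and> f = s powi n * u)"
proof -
  obtain a b where ab: "a \<in> A" "b \<in> A" "b \<noteq> 0" "f = a / b" using fraction by blast
  have "a \<noteq> 0" using ab(4) assms by auto
  obtain \<sigma> c where a: "c \<in> K - {0}" "\<And>R. at_inf R \<Longrightarrow> a * s ^ wt \<sigma> - c \<in> nonunits R"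
    using leading_term[OF ab(1) \<open>a \<noteq> 0\<close>] by blast
  obtain \<tau> d where b: "d \<in> K - {0}" "\<And>R. at_inf R \<Longrightarrow> b * s ^ wt \<tau> - d \<in> nonunits R"
    using leading_term[OF ab(2,3)] by blast
  have "\<exists>u. unit_in R u \<and> f = s powi (int (wt \<tau>) - int (wt \<sigma>)) * u" if inf: "at_inf R" for R
  proof -
    have "unit_in R ((a * s ^ wt \<sigma>) / (b * s ^ wt \<tau>))"
      by (intro unit_divide[OF val[OF inf]] leading_unit[OF a(1) inf a(2)] leading_unit[OF b(1) inf b(2)] inf)
    moreover have "f = s powi (int (wt \<tau>) - int (wt \<sigma>)) * ((a * s ^ wt \<sigma>) / (b * s ^ wt \<tau>))"
      using ab(3,4) s_nz[OF inf] by (simp add: power_int_diff field_simps)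
    ultimately show ?thesis by blast
  qed
  then show ?thesis by blast
qed

lemma at_inf_uniformizer: "at_inf R \<Longrightarrow> uniformizer R s"
  unfolding uniformizer_def using s_nz s_nonunit order_at_inf by blast

text \<open>
  Membership of a fraction is decided by the weights of numerator and denominator, which do not depend
  on the ring.
\<close>

lemma at_inf_unique:
  assumes "at_inf R" "at_inf R'" shows "R = R'"
proof -
  have "f \<in> R \<longleftrightarrow> f \<in> R'" for f
  proof (cases "f = 0")
    case True then show ?thesis using subring_zero[OF Rring] assms by blast
  next
    case False
    then obtain n where n: "\<forall>R. at_inf R \<longrightarrow> (\<exists>u. unit_in R u \<and> f = s powi n * u)"
      using order_at_inf by blast
    have "f \<in> R \<longleftrightarrow> n \<ge> 0" if inf: "at_inf R" for R
    proof -
      obtain u where "unit_in R u" "f = s powi n * u" using n inf by blast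
      then show ?thesis using powi_unit_nonneg[OF val[OF inf] s_nz[OF inf] s_nonunit[OF inf]] by simp
    qed
    then show ?thesis using assms by blast
  qed
  then show ?thesis by blast
qed

section \<open>The Frobenius map on the coordinate ring\<close>

text \<open>
  With \<open>Q = 9\<^sup>t\<^sup>r\<close>, a power of the number \<open>q\<^sup>2\<close> of constants, this is \<open>y\<^sup>Q - y\<close>. For \<open>r > 0\<close> its zeros are the places
  where the residue of \<open>y\<close> lies in the field with \<open>Q\<close> elements, each zero being simple.
\<close>

definition frob_diff :: "nat \<Rightarrow> 'a" where "frob_diff r = y ^ (9 ^ (t * r)) - y"

lemma nine_pow: "(9::nat) ^ (t * r) = 3 ^ (2 * t * r)"
proof -
  have "(9::nat) = 3 ^ 2" by simp
  then show ?thesis by (simp only: power_mult[symmetric] mult.assoc)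
qed

lemma frob_nine: "(a + b) ^ (9 ^ (t * r)) = a ^ (9 ^ (t * r)) + b ^ (9 ^ (t * r))"
    "(a - b) ^ (9 ^ (t * r)) = a ^ (9 ^ (t * r)) - b ^ (9 ^ (t * r))" for a b :: 'a
  unfolding nine_pow by (rule frob)+

lemma frob_diff_in_A: "frob_diff r \<in> A"
  unfolding frob_diff_def by (intro subring_diff subring_power A_subring A_gens)

text \<open>
  Write \<open>j - i = 3\<^sup>e c\<close> with \<open>c\<close> prime to 3. Then \<open>y\<^sup>i - y\<^sup>j = y\<^sup>i (1 - y\<^sup>c)^(3\<^sup>e)\<close> by the
  Frobenius map. By Euler's theorem \<open>c\<close> divides \<open>Q - 1\<close> for some \<open>Q = 9\<^sup>t\<^sup>r\<close>, so both \<open>y\<close> and \<open>1 - y\<^sup>c\<close>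
  divide \<open>y\<^sup>Q - y\<close>.
\<close>

lemma frob_diff_power_in_ideal:
  assumes I: "is_ideal_of A I" and ij: "i < j" "y ^ i - y ^ j \<in> I"
  shows "\<exists>r m. r > 0 \<and> frob_diff r ^ m \<in> I"
proof -
  obtain c where c: "j - i = 3 ^ multiplicity 3 (j - i) * c" "\<not> 3 dvd c"
    using multiplicity_decompose'[of "j - i" 3] ij(1) by auto
  define e where "e = multiplicity 3 (j - i)"
  have ce: "3 ^ e * c = j - i" using c(1) unfolding e_def by simp
  have cpos: "c > 0" using c(2) by (cases c) auto
  have "coprime 3 c" using c(2) by (intro prime_imp_coprime) auto
  then have "coprime (3 ^ (2 * t)) c" by simp
  then have "coprime (9 ^ t) c" using nine_pow[of 1] by (metis mult.right_neutral)
  then have "[(9 ^ t) ^ totient c = 1] (mod c)" by (rule euler_theorem)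
  then have "c dvd (9 ^ t) ^ totient c - 1" by (rule cong_to_1_nat)
  then obtain l where l: "(9 ^ t) ^ totient c - 1 = c * l" by blast
  define r where "r = totient c"
  define Q :: nat where "Q = 9 ^ (t * r)"
  have Q: "Q = Suc (c * l)"
  proof -
    have "(9 ^ t) ^ totient c > (0::nat)" by simp
    then have "(9 ^ t) ^ totient c = Suc (c * l)" using l by linarith
    then show ?thesis unfolding r_def Q_def power_mult .
  qed
  have r: "r > 0" unfolding r_def using cpos by simp
  define G where "G = - (\<Sum>k<l. (y ^ c) ^ k)"
  have GA: "G \<in> A" unfolding G_def
    by (intro subring_minus subring_sum subring_power A_subring A_gens)
  have "1 - y ^ (c * l) = (1 - y ^ c) * (- G)"
    unfolding G_def using one_diff_power_eq[of "y ^ c" l] by (simp add: power_mult)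
  then have "y ^ (c * l) - 1 = (1 - y ^ c) * G" by (simp add: algebra_simps)
  moreover have "frob_diff r = y * (y ^ (c * l) - 1)"
    unfolding frob_diff_def Q_def[symmetric] Q by (simp add: algebra_simps)
  ultimately have frob_diff: "frob_diff r = y * (1 - y ^ c) * G" by simp
  have "y ^ i * (1 - y ^ c) ^ (3 ^ e) = y ^ i - y ^ j"
  proof -
    have e1: "(1 - y ^ c) ^ (3 ^ e) = 1 - y ^ (j - i)"
      unfolding frob ce[symmetric] by (simp add: mult.commute flip: power_mult)
    moreover have "y ^ j = y ^ i * y ^ (j - i)" using ij(1) by (simp flip: power_add)
    ultimately show ?thesis unfolding e1 by (simp add: algebra_simps)
  qed
  then have mem: "y ^ i * (1 - y ^ c) ^ (3 ^ e) \<in> I" using ij(2) by simp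
  have "frob_diff r ^ (i + 3 ^ e) = (y ^ (3 ^ e) * (1 - y ^ c) ^ i * G ^ (i + 3 ^ e)) * (y ^ i * (1 - y ^ c) ^ (3 ^ e))"
    unfolding frob_diff power_mult_distrib by (simp only: power_add mult_ac)
  also have "\<dots> \<in> I"
    by (rule ideal_mult[OF I _ mem])
      (intro subring_mult subring_power subring_diff subring_one A_subring A_gens GA)
  finally show ?thesis using r by blast
qed

text \<open>
  Let \<open>Q = 9\<^sup>t\<^sup>r\<close>. The elements fixed by the \<open>Q\<close>-th power modulo \<open>J\<close> form a ring containing \<open>K\<close> and \<open>y\<close>.
  Applying the curve equation twice gives \<open>x^(q\<^sup>2) = x + \<tau>\<close> with \<open>\<tau>\<close> a polynomial in \<open>y\<close>, and
  by iteration \<open>x\<^sup>Q = x + \<sigma>\<close> with \<open>\<sigma>\<close> in that ring. Modulo \<open>J\<close> every further \<open>Q\<close>-th power adds another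
  \<open>\<sigma>\<close>, and after three of them \<open>3 \<sigma> = 0\<close> is reached. For \<open>r > 0\<close> this shows that
  \<open>A / J\<close> has no nilpotents.
\<close>

lemma frobenius_congruence:
  assumes J: "is_ideal_of A J" and frob_diff: "frob_diff r \<in> J" and g: "g \<in> A"
  shows "g ^ ((9 ^ (t * r)) ^ 3) - g \<in> J"
proof -
  note R = A_subring
  define Q :: nat where "Q = 9 ^ (t * r)"
  have Qpos: "Q > 0" unfolding Q_def by simp
  have fQ: "(a + b) ^ Q = a ^ Q + b ^ Q" "(a - b) ^ Q = a ^ Q - b ^ Q" for a b :: 'a
    unfolding Q_def by (rule frob_nine)+
  have Q3: "Q ^ 3 = 3 ^ (2 * t * r * 3)" unfolding Q_def nine_pow by (simp flip: power_mult)
  have fQ3: "(a + b) ^ (Q ^ 3) = a ^ (Q ^ 3) + b ^ (Q ^ 3)"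
    "(a - b) ^ (Q ^ 3) = a ^ (Q ^ 3) - b ^ (Q ^ 3)" for a b :: 'a
    unfolding Q3 by (rule frob)+
  have QQ: "Q = (q ^ 2) ^ r"
  proof -
    have "(9::nat) = 3 ^ 2" by simp
    then show ?thesis unfolding Q_def q by (simp only: power_mult[symmetric] mult_ac)
  qed
  have stable: "is_subring {g\<in>A. g ^ N - g \<in> J}"
    if N: "\<And>a b::'a. (a - b) ^ N = a ^ N - b ^ N" for N
    unfolding is_subring_def
  proof (intro conjI ballI)
    have "(0::'a) \<in> J" using J unfolding is_ideal_of_def by blast
    then show "1 \<in> {g\<in>A. g ^ N - g \<in> J}" using subring_one[OF R] by simp
    fix g h assume g: "g \<in> {g\<in>A. g ^ N - g \<in> J}" and h: "h \<in> {g\<in>A. g ^ N - g \<in> J}"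
    have "(g ^ N - g) - (h ^ N - h) \<in> J" using g h ideal_diff[OF R J] by blast
    moreover have "(g - h) ^ N - (g - h) = (g ^ N - g) - (h ^ N - h)" unfolding N by simp
    ultimately have "(g - h) ^ N - (g - h) \<in> J" by (simp only:)
    then show "g - h \<in> {g\<in>A. g ^ N - g \<in> J}" using g h subring_diff[OF R] by blast
    have "g ^ N * (h ^ N - h) + h * (g ^ N - g) \<in> J"
      using g h subring_power[OF R] by (intro ideal_add[OF J] ideal_mult[OF J]) auto
    then show "g * h \<in> {g\<in>A. g ^ N - g \<in> J}"
      using g h subring_mult[OF R] by (simp add: algebra_simps power_mult_distrib)
  qed
  define Y where "Y = {g\<in>A. g ^ Q - g \<in> J}"
  have Yring: "is_subring Y" unfolding Y_def by (rule stable) (rule fQ)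
  have KY: "c \<in> Y" if "c \<in> K" for c
  proof -
    have "c ^ (q ^ 2) = c" using finite_subfield_power_card[OF K finK that] cardK by simp
    then have "c ^ ((q ^ 2) ^ k) = c" for k
      by (induction k) (simp_all add: power_mult)
    then show ?thesis unfolding Y_def QQ using that A_gens J unfolding is_ideal_of_def by simp
  qed
  have yY: "y \<in> Y" unfolding Y_def using frob_diff A_gens unfolding frob_diff_def Q_def by simp
  have TY: "T \<in> Y" unfolding T_def by (intro subring_sum subring_power Yring yY)
  define \<tau> where "\<tau> = T ^ 2 - (T ^ 2) ^ q"
  have \<tau>Y: "\<tau> \<in> Y" unfolding \<tau>_def by (intro subring_diff subring_power Yring TY)
  have xqq: "x ^ (q ^ 2) = x + \<tau>"
  proof -
    have "x ^ (q ^ 2) = (x ^ q) ^ q" by (simp add: power2_eq_square power_mult)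
    also have "\<dots> = (- x - T ^ 2) ^ q" unfolding xq ..
    also have "\<dots> = - (x ^ q) - (T ^ 2) ^ q"
      unfolding frob_q(2) unfolding q by simp
    also have "\<dots> = x + \<tau>" unfolding xq \<tau>_def by simp
    finally show ?thesis .
  qed
  have "x ^ ((q ^ 2) ^ k) - x \<in> Y" for k
  proof (induction k)
    case 0 show ?case using subring_zero[OF Yring] by simp
  next
    case (Suc k)
    define \<sigma> where "\<sigma> = x ^ ((q ^ 2) ^ k) - x"
    have "x ^ ((q ^ 2) ^ Suc k) = (x + \<sigma>) ^ (q ^ 2)"
      unfolding \<sigma>_def by (simp add: mult.commute flip: power_mult)
    also have "\<dots> = x + \<tau> + \<sigma> ^ (q ^ 2)"
      unfolding xqq[symmetric] unfolding q power_mult[symmetric] frob by simp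
    finally have "x ^ ((q ^ 2) ^ Suc k) - x = \<tau> + \<sigma> ^ (q ^ 2)" by simp
    then show ?case using subring_add[OF Yring \<tau>Y subring_power[OF Yring]] Suc unfolding \<sigma>_def by metis
  qed
  then have "x ^ Q - x \<in> Y" unfolding QQ by blast
  define \<sigma> where "\<sigma> = x ^ Q - x"
  have \<sigma>Y: "\<sigma> \<in> Y" unfolding \<sigma>_def by fact
  have x1: "x ^ Q = x + \<sigma>" unfolding \<sigma>_def by simp
  have lift: "g ^ (Q ^ 2) - g \<in> J" "g ^ (Q ^ 3) - g \<in> J" if "g \<in> Y" for g
  proof -
    have 0: "g ^ Q - g \<in> J" using that unfolding Y_def by blast
    have "(g ^ Q - g) ^ Q + (g ^ Q - g) \<in> J" by (intro ideal_add[OF J] ideal_power[OF R J] 0 Qpos)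
    then show 1: "g ^ (Q ^ 2) - g \<in> J" unfolding fQ by (simp add: power2_eq_square power_mult)
    have "(g ^ (Q ^ 2) - g) ^ Q + (g ^ Q - g) \<in> J" by (intro ideal_add[OF J] ideal_power[OF R J] 0 1 Qpos)
    then show "g ^ (Q ^ 3) - g \<in> J"
      unfolding fQ by (simp add: power2_eq_square power3_eq_cube power_mult)
  qed
  have x2: "x ^ (Q ^ 3) - x = (\<sigma> ^ Q - \<sigma>) + (\<sigma> ^ (Q ^ 2) - \<sigma>)"
  proof -
    have "x ^ (Q ^ 3) = ((x ^ Q) ^ Q) ^ Q" by (simp add: power3_eq_cube power_mult)
    also have "\<dots> = x + \<sigma> + \<sigma> ^ Q + (\<sigma> ^ Q) ^ Q" unfolding x1 fQ x1 fQ x1 ..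
    finally have "x ^ (Q ^ 3) - x = (\<sigma> ^ Q - \<sigma>) + (\<sigma> ^ (Q ^ 2) - \<sigma>) + 3 * \<sigma>"
      by (simp add: power2_eq_square power_mult)
    then show ?thesis unfolding char3 by simp
  qed
  have "A \<subseteq> {g\<in>A. g ^ (Q ^ 3) - g \<in> J}"
  proof (rule A_minimal)
    show "is_subring {g\<in>A. g ^ (Q ^ 3) - g \<in> J}" by (rule stable) (rule fQ3)
    show "K \<subseteq> {g\<in>A. g ^ (Q ^ 3) - g \<in> J}" using lift(2) KY A_gens by blast
    show "y \<in> {g\<in>A. g ^ (Q ^ 3) - g \<in> J}" using lift(2)[OF yY] A_gens by blast
    have "(\<sigma> ^ Q - \<sigma>) + (\<sigma> ^ (Q ^ 2) - \<sigma>) \<in> J"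
      using \<sigma>Y lift(1)[OF \<sigma>Y] unfolding Y_def by (intro ideal_add[OF J]) auto
    then show "x \<in> {g\<in>A. g ^ (Q ^ 3) - g \<in> J}" using A_gens x2 by simp
  qed
  then show ?thesis using g unfolding Q_def by blast
qed

lemma pow_nine_gt_1: "r > 0 \<Longrightarrow> (9::nat) ^ (t * r) > 1"
  using t by (intro one_less_power) auto

text \<open>
  Only an algebraic \<open>y\<close> could lie in every valuation ring. Its powers would lie in a finite set,
  and the preceding lemmas, for the zero ideal, show that every element of the function field is fixed
  by some power of the Frobenius map. All nonzero elements are then roots of unity, which a valuation ring
  always contains, so that no place exists.
\<close>

lemma exists_at_inf:
  assumes R0: "valuation_ring K R0" shows "\<exists>R. at_inf R"
proof (cases "y \<in> adjoin K (inverse y)")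
  case False
  obtain R where R: "is_subring R" "K \<subseteq> R" "y \<notin> R" "\<And>z. z \<in> R \<or> inverse z \<in> R"
    using exists_valuation_ring_avoiding[OF Kring False] by blast
  have "inverse y \<in> R" using R by blast
  moreover have "inverse y \<notin> K"
    using R(2,3) K unfolding is_subfield_def by (metis inverse_inverse_eq subsetD)
  ultimately have "valuation_ring K R" unfolding valuation_ring_def using R by blast
  then show ?thesis using R(3) unfolding at_inf_def by blast
next
  case True
  have "\<exists>i j. i < j \<and> y ^ i = y ^ j"
  proof -
    obtain n where n: "\<And>k. y ^ k \<in> lin_span K ((\<lambda>i. y ^ i) ` {..n})"
      using integral_powers[OF Kring True] by blast
    define W where "W = lin_span K ((\<lambda>i. y ^ i) ` {..n})"
    have "y ^ k \<in> W" for k using n unfolding W_def .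
    moreover have "finite W" unfolding W_def using finite_lin_span[OF finK Kring] by simp
    ultimately have "\<not> inj (\<lambda>k. y ^ k)"
      using finite_subset[of "range (\<lambda>k. y ^ k)" W] finite_imageD by blast
    then obtain i j :: nat where "i \<noteq> j" "y ^ i = y ^ j" unfolding inj_on_def by blast
    then show ?thesis by (metis nat_neq_iff)
  qed
  then obtain i j where "i < j" "y ^ i - y ^ j \<in> {0}" by auto
  moreover have zero: "is_ideal_of A {0}" unfolding is_ideal_of_def using subring_zero[OF A_subring] by auto
  ultimately obtain r m where r: "r > 0" "frob_diff r ^ m \<in> {0}" using frob_diff_power_in_ideal by blast
  then have "frob_diff r \<in> {0}" by simp
  define N :: nat where "N = (9 ^ (t * r)) ^ 3"
  have N: "N > 1" unfolding N_def using pow_nine_gt_1[OF r(1)] by (metis one_less_power zero_less_numeral)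
  have A: "g ^ N = g" if "g \<in> A" for g
    using frobenius_congruence[OF zero \<open>frob_diff r \<in> {0}\<close> that] unfolding N_def by simp
  have all: "f ^ N = f" for f :: 'a
  proof -
    obtain a b where "a \<in> A" "b \<in> A" "f = a / b" using fraction by blast
    then show ?thesis using A by (simp add: power_divide)
  qed
  obtain f where f: "f \<notin> R0" using R0 unfolding valuation_ring_def by blast
  then have "f \<noteq> 0" using subring_zero[OF val_subring[OF R0]] by blast
  have "inverse f ^ (N - 1) * inverse f = inverse f"
    using all[of "inverse f"] N by (metis mult.commute power_eq_if not_one_less_zero)
  then have "inverse f ^ (N - 1) = 1" using \<open>f \<noteq> 0\<close> by simp
  then show ?thesis
    using nonunits_power[OF R0 inverse_nonunit[OF R0 f], of "N - 1"] one_notin_nonunits[OF R0] N by simp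
qed

end

section \<open>Division with remainder by the order at infinity\<close>

locale curve_inf = curve +
  fixes Rinf assumes inf: "at_inf Rinf"
begin

lemmas valI = val[OF inf]

text \<open>Zero and the elements of \<open>A\<close> whose pole order at infinity is less than \<open>n\<close>.\<close>

definition order_below :: "nat \<Rightarrow> 'a set" where
  "order_below n = {g \<in> A. g * s ^ n \<in> nonunits Rinf}"

lemma order_below_mono: "n \<le> m \<Longrightarrow> order_below n \<subseteq> order_below m"
proof
  fix g assume "n \<le> m" and g: "g \<in> order_below n"
  then have "s ^ m = s ^ n * s ^ (m - n)" by (simp flip: power_add)
  then have "g * s ^ m = (g * s ^ n) * s ^ (m - n)" by (simp only: mult.assoc)
  moreover have "(g * s ^ n) * s ^ (m - n) \<in> nonunits Rinf"
    using g subring_power[OF val_subring[OF valI] nonunits_subset[OF valI s_nonunit[OF inf]]]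
    unfolding order_below_def by (intro nonunits_mult[OF valI, of "g * s ^ n"]) auto
  ultimately have "g * s ^ m \<in> nonunits Rinf" by (simp only:)
  then show "g \<in> order_below m" using g unfolding order_below_def by blast
qed

lemma order_below_zero: "0 \<in> order_below n"
  unfolding order_below_def using zero_nonunit[OF valI] subring_zero[OF A_subring] by simp

lemma leading_inf:
  assumes "g \<in> A" "g \<noteq> 0"
  shows "\<exists>n c. c \<in> K - {0} \<and> g * s ^ n - c \<in> nonunits Rinf"
  using leading_term[OF assms] inf by blast

lemma leading_not_order_below: "c \<in> K - {0} \<Longrightarrow> g * s ^ n - c \<in> nonunits Rinf \<Longrightarrow> g \<notin> order_below n"
  using leading_unit[OF _ inf] unit_not_nonunit[OF valI] unfolding order_below_def by blast

lemma leading_order_below_Suc: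
  assumes "g \<in> A" "c \<in> K - {0}" "g * s ^ n - c \<in> nonunits Rinf"
  shows "g \<in> order_below (Suc n)"
proof -
  have "g * s ^ n * s \<in> nonunits Rinf"
    using leading_unit[OF assms(2) inf assms(3)] unfolding unit_in_def
    by (intro nonunits_mult2[OF valI _ s_nonunit[OF inf]]) auto
  then show ?thesis unfolding order_below_def using assms(1) by (simp add: mult_ac)
qed

lemma order_below_exhaust: "g \<in> A \<Longrightarrow> \<exists>n. g \<in> order_below n"
  using leading_inf leading_order_below_Suc order_below_zero by metis

lemma order_below_0: "order_below 0 = {0}"
proof -
  have "g = 0" if "g \<in> order_below 0" for g
  proof (rule ccontr)
    assume "g \<noteq> 0"
    moreover have "g \<in> A" using that unfolding order_below_def by blast
    ultimately obtain n c where "c \<in> K - {0}" "g * s ^ n - c \<in> nonunits Rinf" using leading_inf by blast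
    then have "g \<notin> order_below n" by (rule leading_not_order_below)
    then show False using order_below_mono[of 0 n] that by blast
  qed
  then show ?thesis using order_below_zero by blast
qed

text \<open>
  Leading coefficients of elements of \<open>A\<close> are constants, so two elements of the same order agree up to a
  constant factor and terms of lower order. The case \<open>c = 0\<close> accounts for elements of order less than \<open>n\<close>.
\<close>

lemma order_below_Suc_residue:
  assumes "g \<in> order_below (Suc n)" shows "\<exists>c\<in>K. g * s ^ n - c \<in> nonunits Rinf"
proof (cases "g \<in> order_below n")
  case True
  then show ?thesis unfolding order_below_def using subring_zero[OF Kring] by (intro bexI[of _ 0]) auto
next
  case False
  have g: "g \<in> A" "g \<noteq> 0" using assms False order_below_zero unfolding order_below_def by auto
  obtain m c where m: "c \<in> K - {0}" "g * s ^ m - c \<in> nonunits Rinf" using leading_inf[OF g] by blast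
  have "m = n"
  proof (rule ccontr)
    assume "m \<noteq> n"
    then consider "Suc n \<le> m" | "Suc m \<le> n" by linarith
    then show False
    proof cases
      case 1
      then show False using order_below_mono leading_not_order_below[OF m] assms by blast
    next
      case 2
      then show False using order_below_mono leading_order_below_Suc[OF g(1) m] False by blast
    qed
  qed
  then show ?thesis using m by blast
qed

lemma finite_order_below: "finite (order_below n)"
proof (induction n)
  case 0 show ?case unfolding order_below_0 by simp
next
  case (Suc n)
  show ?case
  proof (cases "order_below (Suc n) \<subseteq> order_below n")
    case True then show ?thesis using Suc finite_subset by blast
  next
    case False
    then obtain h where h: "h \<in> order_below (Suc n)" "h \<notin> order_below n" by blast
    obtain d where d: "d \<in> K" "h * s ^ n - d \<in> nonunits Rinf" using order_below_Suc_residue[OF h(1)] by blast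
    have hA: "h \<in> A" using h unfolding order_below_def by blast
    have d0: "d \<noteq> 0" using d h hA unfolding order_below_def by auto
    have "g \<in> (\<lambda>(c, f). c * h + f) ` (K \<times> order_below n)" if g: "g \<in> order_below (Suc n)" for g
    proof -
      obtain c where c: "c \<in> K" "g * s ^ n - c \<in> nonunits Rinf" using order_below_Suc_residue[OF g] by blast
      have cd: "c / d \<in> K" using c d K unfolding is_subfield_def by (metis divide_inverse)
      have "(g * s ^ n - c) - c / d * (h * s ^ n - d) \<in> nonunits Rinf"
        by (intro nonunits_diff[OF valI] nonunits_mult2[OF valI] val_const[OF valI] c d cd)
      then have "(g - c / d * h) * s ^ n \<in> nonunits Rinf" using d0 by (simp add: algebra_simps)
      then have "g - c / d * h \<in> order_below n"
        using g subring_diff[OF A_subring _ subring_mult[OF A_subring A_gens(1)[OF cd] hA]]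
        unfolding order_below_def by blast
      then show ?thesis using cd by (intro image_eqI[of _ _ "(c / d, g - c / d * h)"]) auto
    qed
    then have "order_below (Suc n) \<subseteq> (\<lambda>(c, f). c * h + f) ` (K \<times> order_below n)" by blast
    then show ?thesis using finK Suc by (meson finite_SigmaI finite_imageI finite_subset)
  qed
qed

text \<open>
  The weights \<open>q\<close> and \<open>q + 1\<close> alone reach every large number: take as many summands \<open>q + 1\<close> as the
  remainder modulo \<open>q\<close> requires.
\<close>

lemma large_weight:
  assumes "n \<ge> q ^ 2" shows "\<exists>\<tau>. wt \<tau> = n"
proof -
  have "n div q \<ge> q" using div_le_mono[OF assms, of q] q_ge_3 by (simp add: power2_eq_square)
  then have le: "n mod q \<le> n div q" using mod_less_divisor[of q n] q_ge_3 by linarith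
  have "wt (0, n div q - n mod q, n mod q) = q * (n div q - n mod q + n mod q) + n mod q"
    unfolding wt_def by (simp add: algebra_simps)
  also have "\<dots> = n" using le by simp
  finally show ?thesis by blast
qed

lemma mon_in_A: "mon \<tau> \<in> A"
  unfolding mon_def by (cases \<tau>) (auto intro!: subring_mult[OF A_subring] subring_power[OF A_subring] A_gens(2,3) z_in_A)

text \<open>
  Division with remainder by \<open>b\<close> with respect to the order at infinity: as all large numbers are weights,
  some multiple of \<open>b\<close> has the leading term of \<open>g\<close> whenever the order of \<open>g\<close> is large. Since the
  remainders form a finite set, \<open>A / bA\<close> is finite.
\<close>

lemma finite_quotient:
  assumes b: "b \<in> A" "b \<noteq> 0"
  shows "\<exists>N. \<forall>g\<in>A. \<exists>a\<in>A. g - b * a \<in> order_below N"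
proof -
  obtain \<beta> d where d: "d \<in> K - {0}" "b * s ^ \<beta> - d \<in> nonunits Rinf" using leading_inf[OF b] by blast
  have "\<exists>a\<in>A. g - b * a \<in> order_below (\<beta> + q ^ 2)" if "g \<in> order_below n" for g n
    using that
  proof (induction n arbitrary: g)
    case 0
    then show ?case using order_below_0 order_below_zero subring_zero[OF A_subring] by (intro bexI[of _ 0]) auto
  next
    case (Suc n)
    show ?case
    proof (cases "Suc n \<le> \<beta> + q ^ 2")
      case True
      then show ?thesis using Suc.prems order_below_mono subring_zero[OF A_subring] by (intro bexI[of _ 0]) auto
    next
      case False
      then have "n - \<beta> \<ge> q ^ 2" by simp
      then obtain \<tau> where \<tau>: "wt \<tau> = n - \<beta>" using large_weight by blast
      obtain c where c: "c \<in> K" "g * s ^ n - c \<in> nonunits Rinf" using order_below_Suc_residue[OF Suc.prems] by blast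
      have m1: "- 1 \<in> K" using subring_minus[OF Kring subring_one[OF Kring]] .
      have sgK: "sg \<tau> \<in> K" "sg \<tau> \<noteq> 0" unfolding sg_def using m1
        by (cases \<tau>; auto intro!: subring_mult[OF Kring] subring_power[OF Kring])+
      define e where "e = c / (d * sg \<tau>)"
      have "d * sg \<tau> \<in> K" using d sgK subring_mult[OF Kring] by blast
      then have eK: "e \<in> K" unfolding e_def using c K unfolding is_subfield_def by (metis divide_inverse)
      have split: "s ^ n = s ^ \<beta> * s ^ wt \<tau>" unfolding \<tau> using False by (simp flip: power_add)
      have "(b * s ^ \<beta>) * (mon \<tau> * s ^ wt \<tau>) - d * sg \<tau> \<in> nonunits Rinf"
        by (intro cong_mult[OF valI] d mon_lead inf val_const[OF valI] sgK) (use d in blast)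
      then have "(g * s ^ n - c) - e * ((b * s ^ \<beta>) * (mon \<tau> * s ^ wt \<tau>) - d * sg \<tau>) \<in> nonunits Rinf"
        by (intro nonunits_diff[OF valI c(2) nonunits_mult2[OF valI val_const[OF valI eK]]])
      also have "(g * s ^ n - c) - e * ((b * s ^ \<beta>) * (mon \<tau> * s ^ wt \<tau>) - d * sg \<tau>)
          = (g - b * (e * mon \<tau>)) * s ^ n"
      proof -
        have "e * (d * sg \<tau>) = c" unfolding e_def using d sgK by simp
        then show ?thesis unfolding split by (simp add: algebra_simps)
      qed
      finally have "(g - b * (e * mon \<tau>)) * s ^ n \<in> nonunits Rinf" .
      moreover have eA: "e * mon \<tau> \<in> A" using eK A_gens mon_in_A subring_mult[OF A_subring] by blast
      moreover have "g - b * (e * mon \<tau>) \<in> A"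
        using Suc.prems eA b unfolding order_below_def by (auto intro!: subring_diff[OF A_subring] subring_mult[OF A_subring])
      ultimately have "g - b * (e * mon \<tau>) \<in> order_below n" unfolding order_below_def by blast
      from Suc.IH[OF this] obtain a where a: "a \<in> A" "g - b * (e * mon \<tau>) - b * a \<in> order_below (\<beta> + q ^ 2)" by blast
      then have "g - b * (e * mon \<tau> + a) \<in> order_below (\<beta> + q ^ 2)" by (simp add: algebra_simps)
      then show ?thesis using subring_add[OF A_subring eA a(1)] by blast
    qed
  qed
  then show ?thesis using order_below_exhaust by blast
qed

text \<open>
  In the finite ring \<open>A / bA\<close> two powers of \<open>y\<close> coincide.
\<close>

lemma divides_frob_diff_power:
  assumes b: "b \<in> A" "b \<noteq> 0"
  shows "\<exists>r m a. r > 0 \<and> a \<in> A \<and> frob_diff r ^ m = b * a"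
proof -
  obtain N where N: "\<forall>g\<in>A. \<exists>a\<in>A. g - b * a \<in> order_below N" using finite_quotient[OF b] by blast
  have "\<forall>k. \<exists>a\<in>A. y ^ k - b * a \<in> order_below N" using N subring_power[OF A_subring A_gens(3)] by blast
  then obtain a where a: "\<And>k. a k \<in> A" "\<And>k. y ^ k - b * a k \<in> order_below N" by metis
  have "\<not> inj (\<lambda>k. y ^ k - b * a k)"
    using a(2) finite_order_below[of N] finite_subset[of "range (\<lambda>k. y ^ k - b * a k)" "order_below N"] finite_imageD by blast
  then obtain i j where "i \<noteq> j" "y ^ i - b * a i = y ^ j - b * a j" unfolding inj_on_def by blast
  then obtain i j where ij: "i < j" "y ^ i - b * a i = y ^ j - b * a j" by (metis nat_neq_iff)
  have "y ^ i - y ^ j = b * (a i - a j)" using ij(2) by (simp add: algebra_simps)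
  then have "y ^ i - y ^ j \<in> (\<lambda>a. b * a) ` A" using a(1) subring_diff[OF A_subring] by blast
  from frob_diff_power_in_ideal[OF principal_ideal[OF A_subring b(1)] ij(1) this] show ?thesis by blast
qed

lemma frob_diff_nz: assumes "r > 0" shows "frob_diff r \<noteq> 0"
proof
  assume "frob_diff r = 0"
  define Q :: nat where "Q = 9 ^ (t * r)"
  have Q: "Q > 1" unfolding Q_def using pow_nine_gt_1[OF assms] .
  have y0: "y \<noteq> 0" using y_nz[OF inf] .
  have "y ^ (Q - 1) * y = y"
    using \<open>frob_diff r = 0\<close> Q unfolding frob_diff_def Q_def[symmetric]
    by (metis eq_iff_diff_eq_0 mult.commute not_one_less_zero power_eq_if)
  then have "inverse y ^ (Q - 1) = 1" using y0 by (simp add: power_inverse)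
  then show False
    using nonunits_power[OF valI inverse_y[OF inf], of "Q - 1"] one_notin_nonunits[OF valI] Q by simp
qed

text \<open>
  With \<open>p = y\<^sup>Q - y\<close> one has \<open>y^(Q\<^sup>k\<^sup>+\<^sup>1) - y = (y^(Q\<^sup>k) - y)\<^sup>Q + p\<close>. So \<open>p\<close> divides all these elements, and
  wherever \<open>p\<close> vanishes the quotient is congruent to 1.
\<close>

lemma frob_diff_mult:
  "\<exists>a\<in>A. frob_diff (r * k) = frob_diff r * a \<and>
    (r > 0 \<and> k > 0 \<longrightarrow> (\<forall>R. valuation_ring K R \<and> A \<subseteq> R \<and> frob_diff r \<in> nonunits R \<longrightarrow> unit_in R a))"
proof (induction k)
  case 0
  show ?case by (rule bexI[of _ 0]) (auto simp: frob_diff_def subring_zero[OF A_subring])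
next
  case (Suc k)
  then obtain a where a: "a \<in> A" "frob_diff (r * k) = frob_diff r * a" by blast
  define Q :: nat where "Q = 9 ^ (t * r)"
  have Q: "Q > 0" unfolding Q_def by simp
  define a' where "a' = 1 + frob_diff r ^ (Q - 1) * a ^ Q"
  have "y ^ (9 ^ (t * (r * Suc k))) = (y ^ (9 ^ (t * (r * k)))) ^ Q"
    unfolding Q_def by (simp add: algebra_simps flip: power_add power_mult)
  then have "frob_diff (r * Suc k) = frob_diff (r * k) ^ Q + frob_diff r"
    unfolding frob_diff_def Q_def frob_nine by simp
  also have "\<dots> = frob_diff r * a'"
  proof -
    have "frob_diff r ^ Q = frob_diff r * frob_diff r ^ (Q - 1)" using Q by (simp add: power_eq_if)
    then show ?thesis unfolding a(2) a'_def power_mult_distrib by (simp add: algebra_simps)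
  qed
  finally have "frob_diff (r * Suc k) = frob_diff r * a'" .
  moreover have "a' \<in> A" unfolding a'_def
    by (intro subring_add[OF A_subring] subring_mult[OF A_subring] subring_power[OF A_subring]
        subring_one[OF A_subring] frob_diff_in_A a(1))
  moreover have "unit_in R a'" if "r > 0" "valuation_ring K R" "A \<subseteq> R" "frob_diff r \<in> nonunits R" for R
  proof (rule cong_unit[OF that(2) unit_one[OF that(2)]])
    have "Q - 1 > 0" using pow_nine_gt_1[OF that(1)] unfolding Q_def by simp
    moreover have "a ^ Q \<in> R" using subring_power[OF A_subring a(1)] that(3) by blast
    ultimately have "frob_diff r ^ (Q - 1) * a ^ Q \<in> nonunits R"
      by (rule nonunits_mult[OF that(2) nonunits_power[OF that(2,4)]])
    then show "a' - 1 \<in> nonunits R" unfolding a'_def by simp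
  qed
  ultimately show ?case by blast
qed

section \<open>The remaining places\<close>

text \<open>
  The curve equation is an integral equation for \<open>x\<close> over \<open>K[y]\<close>.
\<close>

lemma A_subset_val:
  assumes v: "valuation_ring K R" and y: "y \<in> R" shows "A \<subseteq> R"
proof -
  note R = val_subring[OF v]
  have "x \<in> R"
  proof (rule ccontr)
    assume x: "x \<notin> R"
    then have x0: "x \<noteq> 0" using subring_zero[OF R] by blast
    note u = inverse_nonunit[OF v x]
    have TR: "T \<in> R" unfolding T_def by (intro subring_sum[OF R] subring_power[OF R] y)
    have "1 = x ^ q * inverse x ^ q" using x0 by (simp add: power_inverse)
    also have "\<dots> = - (x * inverse x ^ q) - T ^ 2 * inverse x ^ q" unfolding xq by (simp add: algebra_simps)
    also have "x * inverse x ^ q = inverse x ^ (q - 1)"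
      using x0 q_ge_3 by (simp add: power_eq_if)
    also have "- (inverse x ^ (q - 1)) - T ^ 2 * inverse x ^ q \<in> nonunits R"
      by (rule nonunits_diff[OF v nonunits_minus[OF v nonunits_power[OF v u]]
            nonunits_mult2[OF v subring_power[OF R TR] nonunits_power[OF v u]]])
        (use q_ge_3 in auto)
    finally show False using one_notin_nonunits[OF v] by blast
  qed
  then show ?thesis using A_minimal[OF R] val_const[OF v] y by blast
qed

text \<open>
  Some nonzero \<open>b \<in> A\<close> is a nonunit, and so is \<open>p = y\<^sup>Q - y\<close> for a suitable \<open>Q\<close>, as \<open>b\<close> divides a
  power of such an element. If \<open>a \<in> A\<close> is a nonunit, then \<open>frobenius_congruence\<close> says that
  \<open>a (a\<^sup>N - 1)\<close> is a multiple of \<open>p\<close> in \<open>A\<close> for some \<open>N > 0\<close>. The second factor is a unit, so a factor \<open>p\<close> can be split off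
  from \<open>a\<close>. This stops because every nonzero \<open>g \<in> A\<close> divides a power of \<open>p\<close>, up to units.
\<close>

lemma finite_place_uniformizer:
  assumes v: "valuation_ring K R" and y: "y \<in> R"
  shows "\<exists>r. uniformizer R (frob_diff r)"
proof -
  note R = val_subring[OF v]
  note AR = A_subset_val[OF v y]
  have "\<exists>b\<in>A. b \<noteq> 0 \<and> inverse b \<notin> R"
  proof (rule ccontr)
    assume *: "\<not> ?thesis"
    have "f \<in> R" for f
    proof -
      obtain a b where "a \<in> A" "b \<in> A" "b \<noteq> 0" "f = a / b" using fraction by blast
      then show ?thesis using * AR subring_mult[OF R, of a "inverse b"] by (auto simp: divide_inverse)
    qed
    then show False using v unfolding valuation_ring_def by blast
  qed
  then obtain b where b: "b \<in> A" "b \<noteq> 0" "inverse b \<notin> R" by blast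
  obtain r m c where r: "r > 0" and c: "c \<in> A" "frob_diff r ^ m = b * c" using divides_frob_diff_power[OF b(1,2)] by blast
  define p where "p = frob_diff r"
  have "b \<in> nonunits R" using inverse_nonunit[OF v b(3)] by simp
  then have pm: "p ^ m \<in> nonunits R" unfolding p_def c(2) using nonunits_mult[OF v] c(1) AR by blast
  then have "m > 0" using one_notin_nonunits[OF v] by (cases m) auto
  then have p: "p \<in> nonunits R" using nonunits_power_imp[OF v pm] by blast
  have p0: "p \<noteq> 0" unfolding p_def by (rule frob_diff_nz[OF r])
  have pA: "p \<in> A" unfolding p_def by (rule frob_diff_in_A)
  define Q :: nat where "Q = (9 ^ (t * r)) ^ 3"
  have Q: "Q > 1" unfolding Q_def using pow_nine_gt_1[OF r] by (metis one_less_power zero_less_numeral)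
  have A_form: "\<exists>k u. unit_in R u \<and> g = p ^ k * u" if g: "g \<in> A" "g \<noteq> 0" for g
  proof -
    obtain r1 m1 c1 where r1: "r1 > 0" and c1: "c1 \<in> A" "frob_diff r1 ^ m1 = g * c1"
      using divides_frob_diff_power[OF g] by blast
    obtain a1 where a1: "a1 \<in> A" "frob_diff (r1 * r) = frob_diff r1 * a1" using frob_diff_mult[of r1 r] by blast
    obtain a2 where a2: "unit_in R a2" "frob_diff (r * r1) = p * a2"
      using frob_diff_mult[of r r1] r r1 v AR p unfolding p_def by blast
    have "p ^ m1 * a2 ^ m1 = g * (c1 * a1 ^ m1)"
    proof -
      have "p ^ m1 * a2 ^ m1 = frob_diff (r1 * r) ^ m1"
        unfolding mult.commute[of r1 r] a2(2) power_mult_distrib ..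
      also have "\<dots> = g * (c1 * a1 ^ m1)" unfolding a1(2) power_mult_distrib c1(2) by (simp only: mult.assoc)
      finally show ?thesis .
    qed
    then have "p ^ m1 = g * (c1 * a1 ^ m1 * inverse a2 ^ m1)"
      using a2(1) unfolding unit_in_def by (simp add: field_simps)
    moreover have "c1 * a1 ^ m1 * inverse a2 ^ m1 \<in> R"
      using c1(1) a1(1) a2(1) AR unfolding unit_in_def
      by (intro subring_mult[OF R] subring_power[OF R]) auto
    ultimately obtain \<rho> where \<rho>: "p ^ m1 = g * \<rho>" "\<rho> \<in> R" by blast
    \<comment> \<open>the powers of \<open>p\<close> that can be split off from \<open>g\<close> within \<open>A\<close>, up to units of \<open>R\<close>\<close>
    define X where "X k \<longleftrightarrow> (\<exists>a\<in>A. \<exists>b\<in>A. unit_in R b \<and> g * b = p ^ k * a)" for k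
    have X0: "X 0" unfolding X_def using g unit_one[OF v] subring_one[OF A_subring] by force
    have bound: "k \<le> m1" if "X k" for k
    proof (rule ccontr)
      assume k: "\<not> k \<le> m1"
      obtain a b where ab: "a \<in> A" "b \<in> A" "unit_in R b" "g * b = p ^ k * a"
        using \<open>X k\<close> unfolding X_def by blast
      have "p ^ k = p ^ m1 * p ^ (k - m1)" using k by (simp flip: power_add)
      then have "p ^ m1 * b = p ^ m1 * (p ^ (k - m1) * (a * \<rho>))"
        using \<rho>(1) ab(4) by (metis (no_types, lifting) mult.assoc mult.commute)
      then have "b = p ^ (k - m1) * (a * \<rho>)" using p0 by simp
      also have "\<dots> \<in> nonunits R"
        using k ab(1) AR \<rho>(2) subring_mult[OF R]
        by (intro nonunits_mult[OF v] nonunits_power[OF v p]) auto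
      finally show False using unit_not_nonunit[OF v ab(3)] by blast
    qed
    define k where "k = (GREATEST k. X k)"
    have Xk: "X k" unfolding k_def by (rule GreatestI_nat[of X, OF X0]) (use bound in blast)
    have max: "\<not> X (Suc k)"
      using Greatest_le_nat[of X "Suc k" m1] bound unfolding k_def by fastforce
    obtain a b where ab: "a \<in> A" "b \<in> A" "unit_in R b" "g * b = p ^ k * a" using Xk unfolding X_def by blast
    have "unit_in R a"
    proof (rule ccontr)
      assume "\<not> unit_in R a"
      then have an: "a \<in> nonunits R" using unit_or_nonunit[OF v] ab(1) AR by blast
      have "frob_diff r \<in> (\<lambda>a. p * a) ` A" unfolding p_def using subring_one[OF A_subring] by force
      from frobenius_congruence[OF principal_ideal[OF A_subring pA] this ab(1)]
      obtain a' where a': "a' \<in> A" "a ^ Q - a = p * a'" unfolding Q_def by blast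
      have "a ^ Q = a * a ^ (Q - 1)" using Q by (simp add: power_eq_if)
      then have eq: "a * (a ^ (Q - 1) - 1) = p * a'" using a'(2) by (simp add: algebra_simps)
      define d where "d = a ^ (Q - 1) - 1"
      have dA: "d \<in> A" unfolding d_def
        by (intro subring_diff[OF A_subring] subring_power[OF A_subring] subring_one[OF A_subring] ab)
      have "unit_in R d"
      proof (rule cong_unit[OF v])
        show "unit_in R (- 1)" using subring_minus[OF R subring_one[OF R]] unfolding unit_in_def by simp
        show "d - - 1 \<in> nonunits R" unfolding d_def using nonunits_power[OF v an] Q by simp
      qed
      moreover have "g * (b * d) = p ^ Suc k * a'"
      proof -
        have "g * (b * d) = p ^ k * (a * d)" using ab(4) by (metis mult.assoc)
        then show ?thesis unfolding d_def eq by (simp add: mult_ac)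
      qed
      ultimately have "X (Suc k)" unfolding X_def
        using a'(1) ab dA unit_mult[OF v] subring_mult[OF A_subring] by blast
      then show False using max by blast
    qed
    then have "unit_in R (a / b)" using unit_divide[OF v] ab(3) by blast
    moreover have "g = p ^ k * (a / b)" using ab(3,4) unfolding unit_in_def by (simp add: field_simps)
    ultimately show ?thesis by blast
  qed
  have "uniformizer R p" unfolding uniformizer_def
  proof (intro conjI allI impI p0 p)
    fix f :: 'a assume f: "f \<noteq> 0"
    obtain a b where ab: "a \<in> A" "b \<in> A" "b \<noteq> 0" "f = a / b" using fraction by blast
    then have "a \<noteq> 0" using f by auto
    obtain k u where ku: "unit_in R u" "a = p ^ k * u" using A_form[OF ab(1) \<open>a \<noteq> 0\<close>] by blast
    obtain l w where lw: "unit_in R w" "b = p ^ l * w" using A_form[OF ab(2,3)] by blast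
    have "f = p powi (int k - int l) * (u / w)"
      unfolding ab(4) ku(2) lw(2) using p0 by (simp add: power_int_diff)
    then show "\<exists>n u. unit_in R u \<and> f = p powi n * u" using unit_divide[OF v ku(1) lw(1)] by blast
  qed
  then show ?thesis unfolding p_def by blast
qed

lemma pole_of_val:
  assumes v: "valuation_ring K R" shows "pole_of K (nonunits R) f \<longleftrightarrow> f \<notin> R"
proof -
  have "\<exists>\<pi>. uniformizer R \<pi>"
    using finite_place_uniformizer[OF v] at_inf_uniformizer[of R] v unfolding at_inf_def by blast
  then show ?thesis using pole_of_iff[OF v] by blast
qed

section \<open>The coordinate ring consists of the functions regular away from infinity\<close>

text \<open>
  By Chevalley's theorem such an \<open>f\<close> is integral over \<open>A\<close>. Some power of \<open>p = y\<^sup>Q - y\<close> is a denominator of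
  \<open>f\<close>; it remains to remove one factor at a time. Let \<open>g = p\<^sup>m f \<in> A\<close> with \<open>m > 0\<close>. Since \<open>f\<close> is integral, the
  denominators of its powers are bounded, so high powers of \<open>g\<close> are divisible by \<open>p\<close>. But
  \<open>frobenius_congruence\<close> provides arbitrarily high powers of \<open>g\<close> that are congruent to \<open>g\<close> modulo \<open>p\<close>, so
  \<open>p\<close> divides \<open>g\<close>.
\<close>

lemma regular_imp_in_A:
  assumes reg: "\<And>R. valuation_ring K R \<Longrightarrow> y \<in> R \<Longrightarrow> f \<in> R"
  shows "f \<in> A"
proof -
  note R = A_subring
  have int: "f \<in> adjoin A (inverse f)"
  proof (rule ccontr)
    assume "f \<notin> adjoin A (inverse f)"
    then obtain R where R: "is_subring R" "A \<subseteq> R" "f \<notin> R" "\<forall>z. z \<in> R \<or> inverse z \<in> R"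
      using exists_valuation_ring_avoiding[OF A_subring] by blast
    have "y \<in> R" using R(2) A_gens by blast
    moreover have "y \<notin> K" using inf val_const[OF valI] unfolding at_inf_def by blast
    ultimately have "valuation_ring K R" unfolding valuation_ring_def using R A_gens by blast
    then show False using reg \<open>y \<in> R\<close> R(3) by blast
  qed
  obtain n where n: "\<And>k. f ^ k \<in> lin_span A ((\<lambda>i. f ^ i) ` {..n})"
    using integral_powers[OF R int] by blast
  obtain a b where ab: "a \<in> A" "b \<in> A" "b \<noteq> 0" "f = a / b" using fraction by blast
  obtain r m c where r: "r > 0" and c: "c \<in> A" "frob_diff r ^ m = b * c" using divides_frob_diff_power[OF ab(2,3)] by blast
  define p where "p = frob_diff r"
  have pA: "p \<in> A" unfolding p_def by (rule frob_diff_in_A)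
  have p0: "p \<noteq> 0" unfolding p_def by (rule frob_diff_nz[OF r])
  have "p ^ m * f = a * c" using ab c(2) unfolding p_def by (simp add: field_simps)
  then have "p ^ m * f \<in> A" using ab c subring_mult[OF R] by simp
  then show ?thesis
  proof (induction m)
    case 0 then show ?case by simp
  next
    case (Suc m)
    define g where "g = p ^ Suc m * f"
    have gA: "g \<in> A" using Suc.prems unfolding g_def .
    define l where "l = Suc m * n"
    have bounded: "p ^ l * f ^ k \<in> A" for k
    proof -
      have "p ^ l * f ^ i \<in> A" if "i \<le> n" for i
      proof -
        have "l = Suc m * i + Suc m * (n - i)"
          unfolding l_def using that by (metis add_mult_distrib2 le_add_diff_inverse)
        then have "p ^ l = p ^ (Suc m * i) * p ^ (Suc m * (n - i))" by (simp only: power_add)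
        moreover have "g ^ i = p ^ (Suc m * i) * f ^ i"
          unfolding g_def by (simp only: power_mult_distrib power_mult)
        ultimately have "p ^ l * f ^ i = g ^ i * p ^ (Suc m * (n - i))" by (simp only: mult_ac)
        then show ?thesis using gA pA subring_mult[OF R] subring_power[OF R] by simp
      qed
      then have "p ^ l * f ^ k \<in> lin_span A A"
        using lin_span_mult[OF R _ n[of k], of "p ^ l" A] lin_span_base[OF R] by auto
      moreover have "h \<in> A" if "h \<in> lin_span A A" for h
        using that by induction (auto intro: subring_zero[OF R] subring_add[OF R] subring_mult[OF R])
      ultimately show ?thesis by blast
    qed
    \<comment> \<open>\<open>r * Suc n\<close> instead of \<open>r\<close> makes the exponent exceed \<open>n\<close> and keeps \<open>p\<close> as a divisor\<close>
    define E :: nat where "E = (9 ^ (t * (r * Suc n))) ^ 3"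
    have "n < 9 ^ (t * (r * Suc n))"
    proof -
      have "1 * Suc n \<le> t * r * Suc n" using t r by (intro mult_le_mono1) simp
      then have "Suc n \<le> t * (r * Suc n)" by (simp only: mult.assoc mult_1)
      also have "\<dots> < 9 ^ (t * (r * Suc n))" by (rule power_gt_expt) simp
      finally show ?thesis by simp
    qed
    also have "(9::nat) ^ (t * (r * Suc n)) \<le> E"
      unfolding E_def by (rule self_le_power) auto
    finally have En: "n < E" .
    define J where "J = (\<lambda>a. p * a) ` A"
    have J: "is_ideal_of A J" unfolding J_def by (rule principal_ideal[OF R pA])
    have "frob_diff (r * Suc n) \<in> J" using frob_diff_mult[of r "Suc n"] unfolding J_def p_def by blast
    from frobenius_congruence[OF J this gA] have 1: "g ^ E - g \<in> J" unfolding E_def .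
    have "Suc m * Suc n \<le> Suc m * E" using En by (intro mult_le_mono2) simp
    then have "Suc l \<le> Suc m * E" unfolding l_def by simp
    then obtain e where "Suc m * E = Suc l + e" using le_Suc_ex by blast
    then have e: "Suc m * E = Suc (l + e)" by (simp only: add_Suc)
    have "g ^ E = p ^ Suc (l + e) * f ^ E"
      unfolding g_def power_mult_distrib power_mult[symmetric] e ..
    also have "\<dots> = p * (p ^ e * (p ^ l * f ^ E))"
      by (simp only: power_Suc power_add mult_ac)
    finally have "g ^ E = p * (p ^ e * (p ^ l * f ^ E))" .
    then have "g ^ E \<in> J" unfolding J_def
      using bounded subring_mult[OF R subring_power[OF R pA]] by blast
    from ideal_diff[OF R J this 1] have "g \<in> J" by simp
    then obtain a where "a \<in> A" "g = p * a" unfolding J_def by blast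
    then have "p ^ m * f \<in> A" unfolding g_def using p0 by (simp add: mult.assoc)
    then show ?case by (rule Suc.IH)
  qed
qed

section \<open>The semigroup at infinity\<close>

lemma pole_divisor_A:
  assumes f: "f \<in> A" and u: "unit_in Rinf (f * s ^ n)"
  shows "pole_divisor K f = multiple_of_place n (nonunits Rinf)"
proof
  fix Q
  show "pole_divisor K f Q = multiple_of_place n (nonunits Rinf) Q"
  proof (cases "Q = nonunits Rinf")
    case True
    note un = at_inf_uniformizer[OF inf]
    have "f = s powi (- int n) * (f * s ^ n)"
      using s_nz[OF inf] by (simp add: power_int_minus field_simps)
    then have v: "valuation K (nonunits Rinf) f = - int n" by (rule valuation_eq[OF valI un u])
    have "f \<noteq> 0" using u unfolding unit_in_def by auto
    moreover have "place K (nonunits Rinf)" using place_iff valI by blast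
    ultimately show ?thesis unfolding True pole_divisor_def multiple_of_place_def pole_of_def v by auto
  next
    case False
    have "\<not> pole_of K Q f"
    proof
      assume pole: "pole_of K Q f"
      then obtain R where R: "valuation_ring K R" "Q = nonunits R" unfolding pole_of_def place_iff by blast
      have "\<not> at_inf R" using at_inf_unique[OF inf] False R(2) by blast
      then have "f \<in> R" using A_subset_val[OF R(1)] f R(1) unfolding at_inf_def by blast
      then show False using pole pole_of_val[OF R(1)] R(2) by blast
    qed
    then show ?thesis using False unfolding pole_divisor_def multiple_of_place_def by simp
  qed
qed

text \<open>
  Functions with poles at infinity only lie in \<open>A\<close>, and there the pole order is the weight of the leading
  monomial.
\<close>

lemma semigroup_eq_range_wt: "weierstrass_semigroup K (nonunits Rinf) = range wt"
proof
  show "range wt \<subseteq> weierstrass_semigroup K (nonunits Rinf)"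
  proof
    fix n assume "n \<in> range wt"
    then obtain \<tau> where \<tau>: "n = wt \<tau>" by blast
    have "unit_in Rinf (sg \<tau>)"
      using subring_minus[OF val_subring[OF valI] subring_one[OF val_subring[OF valI]]]
      unfolding sg_def unit_in_def
      by (cases \<tau>) (auto simp: power_inverse[symmetric]
          intro!: subring_mult[OF val_subring[OF valI]] subring_power[OF val_subring[OF valI]])
    then have u: "unit_in Rinf (mon \<tau> * s ^ wt \<tau>)" using cong_unit[OF valI _ mon_lead[OF inf]] by blast
    then have "mon \<tau> \<noteq> 0" unfolding unit_in_def by auto
    then show "n \<in> weierstrass_semigroup K (nonunits Rinf)"
      unfolding weierstrass_semigroup_def \<tau> using pole_divisor_A[OF mon_in_A u] by blast
  qed
  show "weierstrass_semigroup K (nonunits Rinf) \<subseteq> range wt"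
  proof
    fix n assume "n \<in> weierstrass_semigroup K (nonunits Rinf)"
    then obtain f where f: "f \<noteq> 0" "pole_divisor K f = multiple_of_place n (nonunits Rinf)"
      unfolding weierstrass_semigroup_def by blast
    have "f \<in> A"
    proof (rule regular_imp_in_A)
      fix R assume R: "valuation_ring K R" "y \<in> R"
      have "nonunits R \<noteq> nonunits Rinf"
        using nonunits_inj[OF R(1) valI] R(2) inf unfolding at_inf_def by blast
      then have "pole_divisor K f (nonunits R) = 0" using f(2) unfolding multiple_of_place_def by simp
      then have "\<not> pole_of K (nonunits R) f" unfolding pole_divisor_def pole_of_def by (auto split: if_splits)
      then show "f \<in> R" using pole_of_val[OF R(1)] by blast
    qed
    obtain \<tau> c where "c \<in> K - {0}" "f * s ^ wt \<tau> - c \<in> nonunits Rinf"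
      using leading_term[OF \<open>f \<in> A\<close> f(1)] inf by blast
    from pole_divisor_A[OF \<open>f \<in> A\<close> leading_unit[OF this(1) inf this(2)]] f(2)
    have "multiple_of_place n (nonunits Rinf) (nonunits Rinf) = multiple_of_place (wt \<tau>) (nonunits Rinf) (nonunits Rinf)"
      by simp
    then show "n \<in> range wt" unfolding multiple_of_place_def by simp
  qed
qed

lemma range_wt: "range wt = generated_submonoid {2 * q div 3, q, q + 1}"
proof -
  have w: "2 * q div 3 = 2 * w" unfolding q_w by simp
  have "is_nat_submonoid (range wt)" unfolding is_nat_submonoid_def
  proof (intro conjI ballI)
    show "0 \<in> range wt" by (rule range_eqI[of _ _ "(0, 0, 0)"]) (simp add: wt_def)
    fix a b assume "a \<in> range wt" "b \<in> range wt"
    then obtain i j k i' j' k' where "a = wt (i, j, k)" "b = wt (i', j', k')" by auto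
    then show "a + b \<in> range wt"
      by (intro range_eqI[of _ _ "(i + i', j + j', k + k')"]) (simp add: wt_def algebra_simps)
  qed
  moreover have "{2 * w, q, q + 1} \<subseteq> range wt"
  proof -
    have "2 * w = wt (1, 0, 0)" "q = wt (0, 1, 0)" "q + 1 = wt (0, 0, 1)" unfolding wt_def by simp_all
    then show ?thesis by blast
  qed
  ultimately have "generated_submonoid {2 * w, q, q + 1} \<subseteq> range wt"
    unfolding generated_submonoid_def by (intro hull_minimal)
  moreover have "wt \<tau> \<in> generated_submonoid {2 * w, q, q + 1}" for \<tau>
  proof -
    have "wt \<tau> \<in> N" if N: "{2 * w, q, q + 1} \<subseteq> N" "is_nat_submonoid N" for N
    proof -
      have mult: "a * k \<in> N" if "a \<in> N" for a k
        by (induction k) (use that N(2) in \<open>auto simp: is_nat_submonoid_def\<close>)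
      have "2 * w * i + q * j + (q + 1) * k \<in> N" for i j k
        using mult[of "2 * w" i] mult[of q j] mult[of "q + 1" k] N unfolding is_nat_submonoid_def by blast
      then show ?thesis unfolding wt_def by (cases \<tau>) auto
    qed
    then show ?thesis unfolding generated_submonoid_def hull_def by blast
  qed
  ultimately show ?thesis unfolding w by blast
qed

end

theorem theorem2p3:
  fixes K :: "'a::field set" and x y :: 'a and P :: "'a set" and q t :: nat
  assumes "t \<ge> 1" and "q = 3 ^ t"
    and "algebraic_function_field K" and "card K = q ^ 2"
    and "field_adjoin K {x, y} = UNIV"
    and "x ^ q + x + (\<Sum>i<t. y ^ (3 ^ i)) ^ 2 = 0"
    and "pole_of K P x" and "pole_of K P y"
  shows "weierstrass_semigroup K P = generated_submonoid {2 * q div 3, q, q + 1}"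
proof -
  interpret curve K x y q t
    using assms unfolding algebraic_function_field_def by unfold_locales auto
  obtain R where R: "valuation_ring K R" "P = nonunits R"
    using \<open>pole_of K P y\<close> unfolding pole_of_def place_iff by blast
  obtain R' where "at_inf R'" using exists_at_inf[OF R(1)] by blast
  then interpret curve_inf K x y q t R' by unfold_locales
  have "y \<notin> R" using pole_of_val[OF R(1)] \<open>pole_of K P y\<close> R(2) by blast
  then have "R = R'" using at_inf_unique[OF _ inf] R(1) unfolding at_inf_def by blast
  then show ?thesis using semigroup_eq_range_wt range_wt R(2) by simp
qed

end
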